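(* There exists an absolute constant $c_6$ such that the following holds. For each $n$ let $N=n(n-1)/2$ and let $F=F_n$ be a distribution on the positive orthant $\mathbb{R}_+^N$, with one coordinate for each pair $e=ij$, $1\le i<j\le n$, having a down-monotone logconcave density. Let $X$ be a random point from $F$, let $\sigma_e^2=\mathbb{E}(X_e^2)$ for every coordinate $e$, and let $\sigma_{\max}=\max_e\sigma_e$. If $p=p(n)$ satisfies $$p\ge c_6\,\sigma_{\max}\,\frac{\ln n}{n}\cdot\frac{\ln\ln\ln n}{\ln\ln\ln\ln n},$$ then $G_{F,p}$ is Hamiltonian with high probability, i.e. $\Pr(G_{F,p}\text{ is Hamiltonian})\to1$ as $n\to\infty$.
   Context: A function $f:\mathbb{R}^m\to\mathbb{R}_+$ is logconcave if $f(\lambda x+(1-\lambda)y)\ge f(x)^{\lambda}f(y)^{1-\lambda}$ for all $x,y\in\mathbb{R}^m$ and $\lambda\in[0,1]$. A density $f$ supported in the positive orthant $\mathbb{R}_+^m$ is down-monotone if $f(x)\ge f(y)$ for all $x,y\in\mathbb{R}_+^m$ with $x\le y$ coordinatewise. Given a distribution $F$ on $\mathbb{R}_+^N$, $N=n(n-1)/2$, with a coordinate for each pair of vertices in $[n]=\{1,\dots,n\}$, the random graph $G_{F,p}$ has vertex set $[n]$ and is obtained by picking a random point $X$ from $F$ and taking as edges all pairs $ij$ with $X_{ij}\le p$. A graph is Hamiltonian if it contains a cycle through all its vertices. *)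

theory Defs
  imports "HOL-Probability.Probability"
begin

text \<open>
  The space \<open>\<real>\<^sup>I\<close> for a finite index set \<open>I\<close> is represented by the extensional functions
  \<open>I \<rightarrow>\<^sub>E UNIV\<close>, which is the underlying space of the product measure \<open>Pi\<^sub>M I (\<lambda>_. lborel)\<close>,
  i.e. of Lebesgue measure on \<open>\<real>\<^sup>I\<close>.
\<close>

text \<open>
  HOL has \<open>0 powr 0 = 0\<close>, which is harmless here: for \<open>l \<in> {0, 1}\<close> the inequality is trivial
  whatever value is given to \<open>0\<^sup>0 \<in> {0, 1}\<close>.
\<close>

definition logconcave :: "'i set \<Rightarrow> (('i \<Rightarrow> real) \<Rightarrow> real) \<Rightarrow> bool" where
  "logconcave I f \<longleftrightarrow>
     (\<forall>x \<in> I \<rightarrow>\<^sub>E UNIV. 0 \<le> f x) \<and>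
     (\<forall>x \<in> I \<rightarrow>\<^sub>E UNIV. \<forall>y \<in> I \<rightarrow>\<^sub>E UNIV. \<forall>l \<in> {0..1}.
        f (\<lambda>i\<in>I. l * x i + (1 - l) * y i) \<ge> f x powr l * f y powr (1 - l))"

definition supported_in_orthant :: "'i set \<Rightarrow> (('i \<Rightarrow> real) \<Rightarrow> real) \<Rightarrow> bool" where
  "supported_in_orthant I f \<longleftrightarrow> (\<forall>x \<in> I \<rightarrow>\<^sub>E UNIV. (\<exists>i\<in>I. x i < 0) \<longrightarrow> f x = 0)"

definition down_monotone :: "'i set \<Rightarrow> (('i \<Rightarrow> real) \<Rightarrow> real) \<Rightarrow> bool" where
  "down_monotone I f \<longleftrightarrow>
     supported_in_orthant I f \<and>
     (\<forall>x \<in> I \<rightarrow>\<^sub>E {0..}. \<forall>y \<in> I \<rightarrow>\<^sub>E {0..}. (\<forall>i\<in>I. x i \<le> y i) \<longrightarrow> f x \<ge> f y)"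

definition has_density :: "'i set \<Rightarrow> ('i \<Rightarrow> real) measure \<Rightarrow> (('i \<Rightarrow> real) \<Rightarrow> real) \<Rightarrow> bool" where
  "has_density I F f \<longleftrightarrow>
     f \<in> borel_measurable (Pi\<^sub>M I (\<lambda>_. lborel)) \<and>
     F = density (Pi\<^sub>M I (\<lambda>_. lborel)) (\<lambda>x. ennreal (f x))"

definition vertex_pairs :: "nat \<Rightarrow> nat set set" where
  "vertex_pairs n = {{i, j} | i j. 1 \<le> i \<and> i < j \<and> j \<le> n}"

text \<open>
  \<open>F\<close> is the distribution of the random point \<open>X\<close>, and \<open>X\<close> is taken to be the identity on the
  probability space \<open>F\<close>.
\<close>

definition sigma :: "('i \<Rightarrow> real) measure \<Rightarrow> 'i \<Rightarrow> real" where
  "sigma F e = sqrt (\<integral>x. (x e)\<^sup>2 \<partial>F)"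

definition sigma_max :: "'i set \<Rightarrow> ('i \<Rightarrow> real) measure \<Rightarrow> real" where
  "sigma_max I F = (MAX e\<in>I. sigma F e)"

definition graph_edges :: "nat \<Rightarrow> real \<Rightarrow> (nat set \<Rightarrow> real) \<Rightarrow> nat set set" where
  "graph_edges n p x = {e \<in> vertex_pairs n. x e \<le> p}"

text \<open>
  A cycle in the simple graph with edge set \<open>E\<close> is given by the list of its vertices in cyclic
  order, without repetition of the first one.
\<close>

definition is_cycle :: "'v set set \<Rightarrow> 'v list \<Rightarrow> bool" where
  "is_cycle E vs \<longleftrightarrow>
     3 \<le> length vs \<and> distinct vs \<and>
     (\<forall>k < length vs. {vs ! k, vs ! (Suc k mod length vs)} \<in> E)"

definition hamiltonian :: "'v set \<Rightarrow> 'v set set \<Rightarrow> bool" where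
  "hamiltonian V E \<longleftrightarrow> (\<exists>vs. is_cycle E vs \<and> set vs = V)"

end

theory Submission imports Defs "HOL-Real_Asymp.Real_Asymp" begin

text \<open>
  Prekopa-Leindler makes \<open>t \<mapsto> P(X\<^sub>e \<ge> t for all e \<in> S)\<close> log-concave; together with its
  behaviour near \<open>0\<close>, which is governed by the down-monotone marginals, this gives
  \<open>P(X\<^sub>e > p for all e \<in> S) \<le> exp (- p |S| / (4 \<sigma>\<^sub>m\<^sub>a\<^sub>x))\<close> for every set \<open>S\<close> of pairs. So with
  \<open>p \<ge> C \<sigma>\<^sub>m\<^sub>a\<^sub>x ln n / n\<close> the random graph \<open>G\<close> meets simultaneously all members of any family of
  \<open>exp (O(n ln n))\<close> sets of \<open>\<Omega>(n\<^sup>2)\<close> pairs.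

  Such families are used twice. First, \<open>G\<close> contains a connected expander \<open>\<Gamma>\<close> with only \<open>O(n)\<close>
  edges: a greedy choice finds \<open>O(n)\<close> edges of \<open>G\<close> joining all pairs of large vertex sets, and
  an edge-minimal subgraph of \<open>G\<close> containing them and expanding small sets has \<open>O(n)\<close> edges by
  submodularity. Secondly, by Posa's rotations every non-Hamiltonian graph containing \<open>\<Gamma>\<close> has
  \<open>\<Omega>(n\<^sup>2)\<close> boosters, and there are only \<open>exp (O(n ln n))\<close> graphs with \<open>O(n)\<close> edges. Hence \<open>G\<close>
  contains a booster for each of its subgraphs obtained from \<open>\<Gamma>\<close> by adding at most \<open>n\<close> edges, and
  adding boosters one at a time ends in a Hamilton cycle.
\<close>

section \<open>The Prekopa-Leindler inequality for antimonotone functions\<close>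

text \<open>The coordinates of X may be strongly dependent, so edges cannot be exposed in
  independent rounds, and as p is bounded only from below, \<open>G\<close> may be dense. The only
  probabilistic input is a bound on the probability that \<open>G\<close> misses a fixed set of
  pairs; every property used of \<open>G\<close> must therefore say that it meets each member of a
  fixed family. A set of c n^2 pairs is missed with probability exp (- c' n ln n), which pays for
  exp (O(n ln n)) sets but not for one set per subgraph. Hence the booster argument has to run
  inside subgraphs with O(n) edges. The delicate point is the thinning. A greedy choice of few edges
  joining all large pairs (A, B) needs, for each of doubly exponentially many subfamilies of such
  pairs, an edge of \<open>G\<close> serving a constant fraction of it. A subfamily is therefore
  replaced by a sample of m = O(ln n) of its members: there are only exp (O(n ln n)) lists of that
  length, and for each of them \<open>G\<close> is asked to meet the set of vertex pairs that belong
  to at least m / 100 of the members.\<close>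

lemma nn_integral_layer_cake:
  fixes f :: "real \<Rightarrow> real"
  assumes [measurable]: "f \<in> borel_measurable borel" and nonneg: "\<And>t. 0 \<le> f t"
  shows "(\<integral>\<^sup>+t. f t \<partial>lborel) = (\<integral>\<^sup>+r. indicator {0..} r * emeasure lborel {t. r < f t} \<partial>lborel)"
proof -
  have "(\<integral>\<^sup>+t. f t \<partial>lborel) = (\<integral>\<^sup>+t. (\<integral>\<^sup>+r. indicator {0..} r * indicator {t. r < f t} t \<partial>lborel) \<partial>lborel)"
  proof (rule nn_integral_cong)
    fix t :: real
    have "(\<integral>\<^sup>+r. indicator {0..} r * indicator {t. r < f t} t \<partial>lborel)
        = (\<integral>\<^sup>+r. indicator {0..<f t} r \<partial>lborel)"
      by (rule nn_integral_cong) (auto simp: indicator_def)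
    also have "\<dots> = ennreal (f t)"
      using nonneg[of t] by simp
    finally show "ennreal (f t) = (\<integral>\<^sup>+r. indicator {0..} r * indicator {t. r < f t} t \<partial>lborel)" ..
  qed
  also have "\<dots> = (\<integral>\<^sup>+r. (\<integral>\<^sup>+t. indicator {0..} r * indicator {t. r < f t} t \<partial>lborel) \<partial>lborel)"
    by (rule lborel_pair.Fubini'[symmetric]) measurable
  also have "\<dots> = (\<integral>\<^sup>+r. indicator {0..} r * emeasure lborel {t. r < f t} \<partial>lborel)"
    by (rule nn_integral_cong) (simp add: nn_integral_cmult)
  finally show ?thesis .
qed

text \<open>One-dimensional Brunn-Minkowski for intervals: moving from (\<alpha>, \<beta>) to (s, t)
  with one common parameter, the midpoint sweeps, inside \<open>C\<close>, a whole interval of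
  length ((s - \<alpha>) + (t - \<beta>)) / 2. Right ends need not be attained, hence two successive
  suprema.\<close>

lemma interval_midpoint_measure:
  fixes A B C :: "real set"
  assumes A: "\<alpha> \<in> A" "\<And>s. s \<in> A \<Longrightarrow> \<alpha> \<le> s" "\<And>s s'. s \<in> A \<Longrightarrow> \<alpha> \<le> s' \<Longrightarrow> s' \<le> s \<Longrightarrow> s' \<in> A"
    and B: "\<beta> \<in> B" "\<And>s. s \<in> B \<Longrightarrow> \<beta> \<le> s" "\<And>s s'. s \<in> B \<Longrightarrow> \<beta> \<le> s' \<Longrightarrow> s' \<le> s \<Longrightarrow> s' \<in> B"
    and C: "C \<in> sets borel" "\<And>s t. s \<in> A \<Longrightarrow> t \<in> B \<Longrightarrow> (s + t) / 2 \<in> C"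
  shows "emeasure lborel A + emeasure lborel B \<le> 2 * emeasure lborel C"
proof (cases "emeasure lborel C")
  case top
  then show ?thesis by (simp add: ennreal_mult_top)
next
  case (real c)
  have bound: "(s - \<alpha>) + (t - \<beta>) \<le> 2 * c" if st: "s \<in> A" "t \<in> B" for s t
  proof -
    have "{(\<alpha> + \<beta>) / 2 .. (s + t) / 2} \<subseteq> C"
    proof
      fix u assume u: "u \<in> {(\<alpha> + \<beta>) / 2 .. (s + t) / 2}"
      define d where "d = (s + t) / 2 - (\<alpha> + \<beta>) / 2"
      define l where "l = (u - (\<alpha> + \<beta>) / 2) / d"
      have st': "\<alpha> \<le> s" "\<beta> \<le> t" using A(2) B(2) st by auto
      then have d: "0 \<le> d" by (auto simp: d_def field_simps)
      have l: "0 \<le> l" "l \<le> 1"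
        using u d by (auto simp: l_def d_def divide_simps)
      \<comment> \<open>If \<open>d = 0\<close>, then \<open>u\<close> is the common midpoint and
        \<open>x / 0 = 0\<close> gives \<open>l = 0\<close>, so the equation survives.\<close>
      have ld: "l * d = u - (\<alpha> + \<beta>) / 2"
        using u d by (cases "d = 0") (auto simp: l_def d_def)
      have "l * (s - \<alpha>) \<le> s - \<alpha>" "l * (t - \<beta>) \<le> t - \<beta>"
        using l st' mult_right_mono[of l 1 "s - \<alpha>"] mult_right_mono[of l 1 "t - \<beta>"] by auto
      then have "\<alpha> + l * (s - \<alpha>) \<in> A" "\<beta> + l * (t - \<beta>) \<in> B"
        using l st' by (auto intro!: A(3)[OF st(1)] B(3)[OF st(2)])
      then have "((\<alpha> + l * (s - \<alpha>)) + (\<beta> + l * (t - \<beta>))) / 2 \<in> C"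
        by (rule C(2))
      also have "((\<alpha> + l * (s - \<alpha>)) + (\<beta> + l * (t - \<beta>))) / 2 = (\<alpha> + \<beta>) / 2 + l * d"
        by (simp add: d_def field_simps)
      finally show "u \<in> C" by (simp add: ld)
    qed
    then have "emeasure lborel {(\<alpha> + \<beta>) / 2 .. (s + t) / 2} \<le> ennreal c"
      using C(1) real by (metis emeasure_mono sets_lborel)
    moreover have "(\<alpha> + \<beta>) / 2 \<le> (s + t) / 2" using A(2)[OF st(1)] B(2)[OF st(2)] by simp
    ultimately have "(s + t) / 2 - (\<alpha> + \<beta>) / 2 \<le> c"
      using real by simp
    then show ?thesis by (simp add: field_simps)
  qed
  have bddA: "bdd_above A" by (rule bdd_aboveI[of _ "2 * c + \<alpha>"]) (use bound[OF _ B(1)] in force)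
  have bddB: "bdd_above B" by (rule bdd_aboveI[of _ "2 * c + \<beta>"]) (use bound[OF A(1)] in force)
  have "t \<le> 2 * c + \<beta> - (Sup A - \<alpha>)" if "t \<in> B" for t
  proof -
    have "Sup A \<le> 2 * c + \<beta> + \<alpha> - t"
      by (rule cSup_least) (use A(1) bound[OF _ that] in force)+
    then show ?thesis by simp
  qed
  then have "Sup B \<le> 2 * c + \<beta> - (Sup A - \<alpha>)"
    by (intro cSup_least) (use B(1) in auto)
  then have sup: "(Sup A - \<alpha>) + (Sup B - \<beta>) \<le> 2 * c" by simp
  have nn: "0 \<le> Sup A - \<alpha>" "0 \<le> Sup B - \<beta>"
    using cSup_upper[OF A(1) bddA] cSup_upper[OF B(1) bddB] by auto
  have "emeasure lborel A \<le> emeasure lborel {\<alpha>..Sup A}"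
    by (rule emeasure_mono) (use A(2) cSup_upper[OF _ bddA] in auto)
  moreover have "emeasure lborel B \<le> emeasure lborel {\<beta>..Sup B}"
    by (rule emeasure_mono) (use B(2) cSup_upper[OF _ bddB] in auto)
  ultimately have "emeasure lborel A + emeasure lborel B \<le> ennreal (Sup A - \<alpha>) + ennreal (Sup B - \<beta>)"
    using nn by (simp add: add_mono)
  also have "\<dots> = ennreal ((Sup A - \<alpha>) + (Sup B - \<beta>))" using nn by simp
  also have "\<dots> \<le> ennreal (2 * c)" using sup by (rule ennreal_leI)
  also have "\<dots> = 2 * emeasure lborel C" using real by (simp add: ennreal_mult)
  finally show ?thesis .
qed

text \<open>With both maxima equal to 1, the superlevel sets of \<open>f\<close> and
  \<open>g\<close> are nonempty intervals at every level in [0, 1), so the interval estimate applies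
  level by level and integrates to an additive bound.\<close>

lemma prekopa_leindler_interval_normalized:
  fixes f g :: "real \<Rightarrow> real" and H :: "real \<Rightarrow> ennreal"
  assumes meas[measurable]: "f \<in> borel_measurable borel" "g \<in> borel_measurable borel" "H \<in> borel_measurable borel"
    and f: "\<And>t. 0 \<le> f t" "\<And>t. t < \<alpha> \<Longrightarrow> f t = 0" "\<And>s t. \<alpha> \<le> s \<Longrightarrow> s \<le> t \<Longrightarrow> f t \<le> f s" "f \<alpha> = 1"
    and g: "\<And>t. 0 \<le> g t" "\<And>t. t < \<beta> \<Longrightarrow> g t = 0" "\<And>s t. \<beta> \<le> s \<Longrightarrow> s \<le> t \<Longrightarrow> g t \<le> g s" "g \<beta> = 1"
    and H: "\<And>s t. \<alpha> \<le> s \<Longrightarrow> \<beta> \<le> t \<Longrightarrow> ennreal (f s * g t) \<le> (H ((s + t) / 2))\<^sup>2"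
  shows "(\<integral>\<^sup>+t. f t \<partial>lborel) + (\<integral>\<^sup>+t. g t \<partial>lborel) \<le> 2 * (\<integral>\<^sup>+t. H t \<partial>lborel)"
proof -
  \<comment> \<open>Levels \<open>r \<ge> 1\<close> contribute nothing to the left-hand side, so
    truncating \<open>H\<close> at 1 is harmless; it gives a real-valued function, as the layer-cake
    formula requires.\<close>
  define h where "h t = enn2real (min (H t) 1)" for t
  have h_meas[measurable]: "h \<in> borel_measurable borel" unfolding h_def by measurable
  have h_H: "ennreal (h t) = min (H t) 1" for t
    unfolding h_def by (rule ennreal_enn2real) (simp add: min_def less_top[symmetric], metis ennreal_one_neq_top le_cases neq_top_trans)
  have le1: "f t \<le> 1" "g t \<le> 1" for t
    using f(2)[of t] f(3)[of \<alpha> t] f(4) g(2)[of t] g(3)[of \<beta> t] g(4) by (cases "t < \<alpha>"; cases "t < \<beta>"; simp)+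
  have level: "indicator {0..} r * emeasure lborel {t. r < f t} + indicator {0..} r * emeasure lborel {t. r < g t}
     \<le> 2 * (indicator {0..} r * emeasure lborel {t. r < h t})" for r :: real
  proof -
    consider "r < 0" | "r \<ge> 1" | "0 \<le> r" "r < 1" by linarith
    then show ?thesis
    proof cases
      case 2
      then have "{t. r < f t} = {}" "{t. r < g t} = {}" using le1 by (auto simp: not_less intro: order_trans)
      then show ?thesis by simp
    next
      case 3
      have "emeasure lborel {t. r < f t} + emeasure lborel {t. r < g t} \<le> 2 * emeasure lborel {t. r < h t}"
      proof (rule interval_midpoint_measure[where \<alpha>=\<alpha> and \<beta>=\<beta>])
        fix s t assume "s \<in> {t. r < f t}" "t \<in> {t. r < g t}"
        then have st: "r < f s" "r < g t" by auto
        then have ge: "\<alpha> \<le> s" "\<beta> \<le> t" using f(2)[of s] g(2)[of t] 3 by (force simp: not_less[symmetric])+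
        have "r * r < f s * g t" using st 3 by (intro mult_strict_mono) auto
        then have "ennreal (r * r) < (H ((s + t) / 2))\<^sup>2"
          using H[OF ge] 3 by (meson ennreal_lessI less_le_trans not_less order_trans mult_nonneg_nonneg le_less_trans)
        then have "(ennreal r)\<^sup>2 < (H ((s + t) / 2))\<^sup>2"
          using 3 by (simp add: power2_eq_square ennreal_mult)
        then have "ennreal r < H ((s + t) / 2)"
          by (meson not_less power_mono zero_le)
        then have "ennreal r < ennreal (h ((s + t) / 2))"
          unfolding h_H using 3 by (auto simp: min_def ennreal_less_one_iff)
        then show "(s + t) / 2 \<in> {t. r < h t}"
          using 3 by (simp add: ennreal_less_iff)
      qed (use 3 f g in \<open>auto simp: not_less[symmetric] intro: less_le_trans\<close>)
      then show ?thesis using 3 by simp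
    qed simp
  qed
  have "(\<integral>\<^sup>+t. f t \<partial>lborel) + (\<integral>\<^sup>+t. g t \<partial>lborel)
    = (\<integral>\<^sup>+r. indicator {0..} r * emeasure lborel {t. r < f t} + indicator {0..} r * emeasure lborel {t. r < g t} \<partial>lborel)"
    using f(1) g(1) by (subst (1 2) nn_integral_layer_cake) (auto intro!: nn_integral_add[symmetric])
  also have "\<dots> \<le> (\<integral>\<^sup>+r. 2 * (indicator {0..} r * emeasure lborel {t. r < h t}) \<partial>lborel)"
    by (intro nn_integral_mono level)
  also have "\<dots> = 2 * (\<integral>\<^sup>+r. indicator {0..} r * emeasure lborel {t. r < h t} \<partial>lborel)"
    by (rule nn_integral_cmult) measurable
  also have "\<dots> = 2 * (\<integral>\<^sup>+t. h t \<partial>lborel)"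
    by (subst nn_integral_layer_cake[symmetric]) (auto simp: h_def)
  also have "\<dots> \<le> 2 * (\<integral>\<^sup>+t. H t \<partial>lborel)"
    by (intro mult_left_mono nn_integral_mono) (auto simp: h_H)
  finally show ?thesis .
qed

lemma ennreal_mult_le_square_if_add_le:
  fixes X Y Z :: ennreal
  assumes "X + Y \<le> 2 * Z"
  shows "X * Y \<le> Z\<^sup>2"
proof (cases "Z = \<infinity>")
  case True
  then show ?thesis by (simp add: power2_eq_square ennreal_mult_top)
next
  case False
  then obtain z where z: "Z = ennreal z" "0 \<le> z" by (cases Z) auto
  then have "2 * Z = ennreal (2 * z)" by (simp add: ennreal_mult)
  with assms have le: "X + Y \<le> ennreal (2 * z)" by simp
  then have "X \<noteq> top" "Y \<noteq> top" by (auto simp: top_unique)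
  then obtain x y where xy: "X = ennreal x" "0 \<le> x" "Y = ennreal y" "0 \<le> y"
    by (metis ennreal_cases)
  have "x + y \<le> 2 * z" using le xy z by (simp flip: ennreal_plus)
  then have "(x + y)\<^sup>2 \<le> (2 * z)\<^sup>2" using xy by (intro power_mono) auto
  moreover have "4 * (x * y) \<le> (x + y)\<^sup>2" using zero_le_power2[of "x - y"] by (simp add: power2_eq_square algebra_simps)
  ultimately have "x * y \<le> z\<^sup>2" by (simp add: power_mult_distrib)
  then have "ennreal (x * y) \<le> ennreal (z\<^sup>2)" by (rule ennreal_leI)
  then show ?thesis using xy z by (simp add: ennreal_mult ennreal_power)
qed

text \<open>Dividing \<open>F\<close> and \<open>G\<close> by their maxima \<open>a\<close>,
  \<open>b\<close> and \<open>H\<close> by sqrt (a b) preserves the midpoint hypothesis and reduces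
  to maxima 1; AM-GM turns the additive bound into the product bound.\<close>

lemma prekopa_leindler_interval_finite:
  fixes F G H :: "real \<Rightarrow> ennreal"
  assumes meas[measurable]: "F \<in> borel_measurable borel" "G \<in> borel_measurable borel" "H \<in> borel_measurable borel"
    and F: "\<And>t. t < \<alpha> \<Longrightarrow> F t = 0" "\<And>s t. \<alpha> \<le> s \<Longrightarrow> s \<le> t \<Longrightarrow> F t \<le> F s" "F \<alpha> < \<infinity>"
    and G: "\<And>t. t < \<beta> \<Longrightarrow> G t = 0" "\<And>s t. \<beta> \<le> s \<Longrightarrow> s \<le> t \<Longrightarrow> G t \<le> G s" "G \<beta> < \<infinity>"
    and H: "\<And>s t. \<alpha> \<le> s \<Longrightarrow> \<beta> \<le> t \<Longrightarrow> F s * G t \<le> (H ((s + t) / 2))\<^sup>2"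
  shows "(\<integral>\<^sup>+t. F t \<partial>lborel) * (\<integral>\<^sup>+t. G t \<partial>lborel) \<le> (\<integral>\<^sup>+t. H t \<partial>lborel)\<^sup>2"
proof (cases "F \<alpha> = 0 \<or> G \<beta> = 0")
  case True
  then show ?thesis
  proof
    assume "F \<alpha> = 0"
    then have "F t = 0" for t using F(1)[of t] F(2)[of \<alpha> t] by (cases "t < \<alpha>") auto
    then show ?thesis by simp
  next
    assume "G \<beta> = 0"
    then have "G t = 0" for t using G(1)[of t] G(2)[of \<beta> t] by (cases "t < \<beta>") auto
    then show ?thesis by simp
  qed
next
  case False
  obtain a where a: "F \<alpha> = ennreal a" "0 \<le> a" using F(3) by (cases "F \<alpha>") auto
  obtain b where b: "G \<beta> = ennreal b" "0 \<le> b" using G(3) by (cases "G \<beta>") auto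
  have ab: "0 < a" "0 < b" using False a b by (auto simp: less_le)
  define f where "f t = enn2real (F t) / a" for t
  define g where "g t = enn2real (G t) / b" for t
  have Ffin: "F t < \<infinity>" for t using F(1)[of t] F(2)[of \<alpha> t] F(3) by (cases "t < \<alpha>") (auto simp: le_less_trans)
  have Gfin: "G t < \<infinity>" for t using G(1)[of t] G(2)[of \<beta> t] G(3) by (cases "t < \<beta>") (auto simp: le_less_trans)
  have Ff: "F t = ennreal a * ennreal (f t)" for t
    using ab Ffin[of t] by (simp add: f_def ennreal_mult[symmetric])
  have Gg: "G t = ennreal b * ennreal (g t)" for t
    using ab Gfin[of t] by (simp add: g_def ennreal_mult[symmetric])
  have fm[measurable]: "f \<in> borel_measurable borel" "g \<in> borel_measurable borel"
    unfolding f_def g_def by measurable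
  define c where "c = 1 / sqrt (a * b)"
  have c: "0 < c" "c\<^sup>2 * (a * b) = 1" using ab by (auto simp: c_def power_divide)
  have "(\<integral>\<^sup>+t. f t \<partial>lborel) + (\<integral>\<^sup>+t. g t \<partial>lborel) \<le> 2 * (\<integral>\<^sup>+t. ennreal c * H t \<partial>lborel)"
  proof (rule prekopa_leindler_interval_normalized[where \<alpha>=\<alpha> and \<beta>=\<beta>])
    fix s t assume "\<alpha> \<le> s" "s \<le> t"
    then show "f t \<le> f s" using F(2)[of s t] Ffin[of s] ab by (auto simp: f_def divide_right_mono enn2real_mono)
  next
    fix s t assume "\<beta> \<le> s" "s \<le> t"
    then show "g t \<le> g s" using G(2)[of s t] Gfin[of s] ab by (auto simp: g_def divide_right_mono enn2real_mono)
  next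
    fix s t assume st: "\<alpha> \<le> s" "\<beta> \<le> t"
    have f0: "0 \<le> f s" "0 \<le> g t" using ab by (auto simp: f_def g_def)
    have "ennreal (f s * g t) = ennreal (c\<^sup>2 * (a * b) * (f s * g t))" using c by simp
    also have "\<dots> = ennreal (c\<^sup>2) * (F s * G t)"
      using f0 ab by (simp add: Ff Gg ennreal_mult mult_ac)
    also have "\<dots> \<le> ennreal (c\<^sup>2) * (H ((s + t) / 2))\<^sup>2"
      by (intro mult_left_mono H st) auto
    also have "\<dots> = (ennreal c * H ((s + t) / 2))\<^sup>2"
      using c by (simp add: power_mult_distrib ennreal_power)
    finally show "ennreal (f s * g t) \<le> (ennreal c * H ((s + t) / 2))\<^sup>2" .
  qed (use ab F G a b in \<open>auto simp: f_def g_def\<close>)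
  also have "\<dots> = 2 * (ennreal c * (\<integral>\<^sup>+t. H t \<partial>lborel))"
    by (simp add: nn_integral_cmult)
  finally have "(\<integral>\<^sup>+t. f t \<partial>lborel) * (\<integral>\<^sup>+t. g t \<partial>lborel) \<le> (ennreal c * (\<integral>\<^sup>+t. H t \<partial>lborel))\<^sup>2"
    by (rule ennreal_mult_le_square_if_add_le)
  then have "ennreal (a * b) * ((\<integral>\<^sup>+t. f t \<partial>lborel) * (\<integral>\<^sup>+t. g t \<partial>lborel)) \<le> ennreal (a * b) * (ennreal c * (\<integral>\<^sup>+t. H t \<partial>lborel))\<^sup>2"
    by (rule mult_left_mono) simp
  also have "\<dots> = ennreal (c\<^sup>2 * (a * b)) * (\<integral>\<^sup>+t. H t \<partial>lborel)\<^sup>2"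
    using c(1) ab by (simp only: power_mult_distrib ennreal_power less_imp_le) (simp add: ennreal_mult mult_ac)
  also have "\<dots> = (\<integral>\<^sup>+t. H t \<partial>lborel)\<^sup>2" using c by simp
  also have "ennreal (a * b) * ((\<integral>\<^sup>+t. f t \<partial>lborel) * (\<integral>\<^sup>+t. g t \<partial>lborel)) = (\<integral>\<^sup>+t. F t \<partial>lborel) * (\<integral>\<^sup>+t. G t \<partial>lborel)"
    unfolding Ff Gg using ab by (simp add: nn_integral_cmult ennreal_mult mult_ac)
  finally show ?thesis .
qed

lemma ennreal_SUP_min_of_nat: "(SUP k. min x (of_nat k)) = (x::ennreal)"
proof (cases "x = \<infinity>")
  case True
  then show ?thesis by (simp add: ennreal_SUP_of_nat_eq_top)
next
  case False
  then obtain k where "x \<le> of_nat k"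
    by (metis ennreal_Ex_less_of_nat infinity_ennreal_def less_imp_le less_top)
  then show ?thesis
    by (intro antisym SUP_least SUP_upper2[of k]) auto
qed

lemma nn_integral_SUP_min_of_nat:
  assumes [measurable]: "F \<in> borel_measurable M"
  shows "(\<integral>\<^sup>+t. F t \<partial>M) = (SUP k. \<integral>\<^sup>+t. min (F t) (of_nat k) \<partial>M)"
proof -
  have "(\<integral>\<^sup>+t. F t \<partial>M) = (\<integral>\<^sup>+t. (SUP k. min (F t) (of_nat k)) \<partial>M)"
    by (simp add: ennreal_SUP_min_of_nat)
  also have "\<dots> = (SUP k. \<integral>\<^sup>+t. min (F t) (of_nat k) \<partial>M)"
    by (rule nn_integral_monotone_convergence_SUP)
       (auto simp: incseq_def le_fun_def intro: min.coboundedI2 min.mono)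
  finally show ?thesis .
qed

lemma prekopa_leindler_interval:
  fixes F G H :: "real \<Rightarrow> ennreal"
  assumes meas[measurable]: "F \<in> borel_measurable borel" "G \<in> borel_measurable borel" "H \<in> borel_measurable borel"
    and F: "\<And>t. t < \<alpha> \<Longrightarrow> F t = 0" "\<And>s t. \<alpha> \<le> s \<Longrightarrow> s \<le> t \<Longrightarrow> F t \<le> F s"
    and G: "\<And>t. t < \<beta> \<Longrightarrow> G t = 0" "\<And>s t. \<beta> \<le> s \<Longrightarrow> s \<le> t \<Longrightarrow> G t \<le> G s"
    and H: "\<And>s t. \<alpha> \<le> s \<Longrightarrow> \<beta> \<le> t \<Longrightarrow> F s * G t \<le> (H ((s + t) / 2))\<^sup>2"
  shows "(\<integral>\<^sup>+t. F t \<partial>lborel) * (\<integral>\<^sup>+t. G t \<partial>lborel) \<le> (\<integral>\<^sup>+t. H t \<partial>lborel)\<^sup>2"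
proof -
  have trunc: "(\<integral>\<^sup>+t. min (F t) (of_nat k) \<partial>lborel) * (\<integral>\<^sup>+t. min (G t) (of_nat l) \<partial>lborel) \<le> (\<integral>\<^sup>+t. H t \<partial>lborel)\<^sup>2" for k l
  proof (rule prekopa_leindler_interval_finite[where \<alpha>=\<alpha> and \<beta>=\<beta>])
    fix s t assume "\<alpha> \<le> s" "\<beta> \<le> t"
    then have "F s * G t \<le> (H ((s + t) / 2))\<^sup>2" by (rule H)
    moreover have "min (F s) (of_nat k) * min (G t) (of_nat l) \<le> F s * G t" by (intro mult_mono) auto
    ultimately show "min (F s) (of_nat k) * min (G t) (of_nat l) \<le> (H ((s + t) / 2))\<^sup>2" by simp
  qed (use F G in \<open>auto intro: min.coboundedI1 simp: min_less_iff_disj of_nat_less_top\<close>)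
  show ?thesis
    unfolding nn_integral_SUP_min_of_nat[of F lborel, simplified]
      nn_integral_SUP_min_of_nat[of G lborel, simplified]
    by (simp add: SUP_mult_left_ennreal SUP_mult_right_ennreal trunc SUP_least)
qed

text \<open>Antimonotonicity survives integrating out a coordinate, so in every one-variable step the
  superlevel sets are intervals and no general Brunn-Minkowski inequality is needed.\<close>

lemma prekopa_leindler_antimono:
  fixes F G H :: "('i \<Rightarrow> real) \<Rightarrow> ennreal"
  assumes "finite I"
    and "F \<in> borel_measurable (Pi\<^sub>M I (\<lambda>_. lborel))" "G \<in> borel_measurable (Pi\<^sub>M I (\<lambda>_. lborel))"
      "H \<in> borel_measurable (Pi\<^sub>M I (\<lambda>_. lborel))"
    and "\<And>x. x \<in> I \<rightarrow>\<^sub>E UNIV \<Longrightarrow> \<exists>i\<in>I. x i < \<alpha> i \<Longrightarrow> F x = 0"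
    and "\<And>x y. x \<in> I \<rightarrow>\<^sub>E UNIV \<Longrightarrow> y \<in> I \<rightarrow>\<^sub>E UNIV \<Longrightarrow> \<forall>i\<in>I. \<alpha> i \<le> x i \<and> x i \<le> y i \<Longrightarrow> F y \<le> F x"
    and "\<And>x. x \<in> I \<rightarrow>\<^sub>E UNIV \<Longrightarrow> \<exists>i\<in>I. x i < \<beta> i \<Longrightarrow> G x = 0"
    and "\<And>x y. x \<in> I \<rightarrow>\<^sub>E UNIV \<Longrightarrow> y \<in> I \<rightarrow>\<^sub>E UNIV \<Longrightarrow> \<forall>i\<in>I. \<beta> i \<le> x i \<and> x i \<le> y i \<Longrightarrow> G y \<le> G x"
    and "\<And>x y. x \<in> I \<rightarrow>\<^sub>E UNIV \<Longrightarrow> y \<in> I \<rightarrow>\<^sub>E UNIV \<Longrightarrow> \<forall>i\<in>I. \<alpha> i \<le> x i \<Longrightarrow> \<forall>i\<in>I. \<beta> i \<le> y i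
      \<Longrightarrow> F x * G y \<le> (H (\<lambda>i\<in>I. (x i + y i) / 2))\<^sup>2"
  shows "(\<integral>\<^sup>+x. F x \<partial>Pi\<^sub>M I (\<lambda>_. lborel)) * (\<integral>\<^sup>+x. G x \<partial>Pi\<^sub>M I (\<lambda>_. lborel))
    \<le> (\<integral>\<^sup>+x. H x \<partial>Pi\<^sub>M I (\<lambda>_. lborel))\<^sup>2"
  using assms
proof (induction I arbitrary: F G H rule: finite_induct)
  case empty
  interpret product_sigma_finite "\<lambda>_::'i. lborel :: real measure" by standard
  have u: "(\<lambda>_. undefined) \<in> {} \<rightarrow>\<^sub>E (UNIV :: real set)" by simp
  have "F (\<lambda>_. undefined) * G (\<lambda>_. undefined) \<le> (H (\<lambda>_. undefined))\<^sup>2"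
    using empty(8)[OF u u] by (simp add: restrict_def)
  then show ?case by (simp add: nn_integral_empty)
next
  case (insert i I)
  interpret product_sigma_finite "\<lambda>_::'i. lborel :: real measure" by standard
  note fin = insert(1,2)
  note [measurable] = insert(4,5,6)
  have upd: "x(i := t) \<in> insert i I \<rightarrow>\<^sub>E UNIV" if "x \<in> I \<rightarrow>\<^sub>E UNIV" for x :: "'i \<Rightarrow> real" and t
    using that by (auto simp: PiE_iff extensional_def)
  have sect: "(\<lambda>t. K (x(i := t))) \<in> borel_measurable borel"
    if "K \<in> borel_measurable (Pi\<^sub>M (insert i I) (\<lambda>_. lborel))" "x \<in> I \<rightarrow>\<^sub>E UNIV"
    for K :: "_ \<Rightarrow> ennreal" and x
    using measurable_comp[OF measurable_component_update that(1), of x] that(2) fin(2)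
    by (simp add: comp_def space_PiM fun_upd_def)
  have not_i: "j \<noteq> i" if "j \<in> I" for j using that fin by auto
  show ?case
    unfolding product_nn_integral_insert[OF fin insert(4)] product_nn_integral_insert[OF fin insert(5)]
      product_nn_integral_insert[OF fin insert(6)]
  proof (rule insert.IH)
    show "(\<lambda>x. \<integral>\<^sup>+y. F (x(i := y)) \<partial>lborel) \<in> borel_measurable (Pi\<^sub>M I (\<lambda>_. lborel))" by measurable
    show "(\<lambda>x. \<integral>\<^sup>+y. G (x(i := y)) \<partial>lborel) \<in> borel_measurable (Pi\<^sub>M I (\<lambda>_. lborel))" by measurable
    show "(\<lambda>x. \<integral>\<^sup>+y. H (x(i := y)) \<partial>lborel) \<in> borel_measurable (Pi\<^sub>M I (\<lambda>_. lborel))" by measurable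
  next
    fix x :: "'i \<Rightarrow> real" assume x: "x \<in> I \<rightarrow>\<^sub>E UNIV" "\<exists>j\<in>I. x j < \<alpha> j"
    then have "F (x(i := t)) = 0" for t by (intro insert(7) upd) (auto simp: not_i intro!: bexI)
    then show "(\<integral>\<^sup>+y. F (x(i := y)) \<partial>lborel) = 0" by simp
  next
    fix x :: "'i \<Rightarrow> real" assume x: "x \<in> I \<rightarrow>\<^sub>E UNIV" "\<exists>j\<in>I. x j < \<beta> j"
    then have "G (x(i := t)) = 0" for t by (intro insert(9) upd) (auto simp: not_i intro!: bexI)
    then show "(\<integral>\<^sup>+y. G (x(i := y)) \<partial>lborel) = 0" by simp
  next
    fix x y :: "'i \<Rightarrow> real" assume xy: "x \<in> I \<rightarrow>\<^sub>E UNIV" "y \<in> I \<rightarrow>\<^sub>E UNIV" "\<forall>j\<in>I. \<alpha> j \<le> x j \<and> x j \<le> y j"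
    \<comment> \<open>Antimonotonicity is given only for coordinates above \<alpha>; for smaller
      \<open>t\<close> the left-hand side vanishes.\<close>
    have "F (y(i := t)) \<le> F (x(i := t))" for t
    proof (cases "t < \<alpha> i")
      case True
      then have "F (y(i := t)) = 0" using xy by (intro insert(7) upd) auto
      then show ?thesis by simp
    qed (use xy in \<open>auto intro!: insert(8) upd simp: not_i\<close>)
    then show "(\<integral>\<^sup>+t. F (y(i := t)) \<partial>lborel) \<le> (\<integral>\<^sup>+t. F (x(i := t)) \<partial>lborel)"
      by (intro nn_integral_mono)
  next
    fix x y :: "'i \<Rightarrow> real" assume xy: "x \<in> I \<rightarrow>\<^sub>E UNIV" "y \<in> I \<rightarrow>\<^sub>E UNIV" "\<forall>j\<in>I. \<beta> j \<le> x j \<and> x j \<le> y j"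
    have "G (y(i := t)) \<le> G (x(i := t))" for t
    proof (cases "t < \<beta> i")
      case True
      then have "G (y(i := t)) = 0" using xy by (intro insert(9) upd) auto
      then show ?thesis by simp
    qed (use xy in \<open>auto intro!: insert(10) upd simp: not_i\<close>)
    then show "(\<integral>\<^sup>+t. G (y(i := t)) \<partial>lborel) \<le> (\<integral>\<^sup>+t. G (x(i := t)) \<partial>lborel)"
      by (intro nn_integral_mono)
  next
    fix x y :: "'i \<Rightarrow> real"
    assume xy: "x \<in> I \<rightarrow>\<^sub>E UNIV" "y \<in> I \<rightarrow>\<^sub>E UNIV" "\<forall>j\<in>I. \<alpha> j \<le> x j" "\<forall>j\<in>I. \<beta> j \<le> y j"
    define z where "z = (\<lambda>j\<in>I. (x j + y j) / 2)"
    have z: "z \<in> I \<rightarrow>\<^sub>E UNIV" by (simp add: z_def)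
    have mid: "(\<lambda>j\<in>insert i I. ((x(i := s)) j + (y(i := t)) j) / 2) = z(i := (s + t) / 2)" for s t
      by (auto simp: z_def fun_eq_iff restrict_def not_i)
    show "(\<integral>\<^sup>+t. F (x(i := t)) \<partial>lborel) * (\<integral>\<^sup>+t. G (y(i := t)) \<partial>lborel)
        \<le> (\<integral>\<^sup>+t. H ((\<lambda>j\<in>I. (x j + y j) / 2)(i := t)) \<partial>lborel)\<^sup>2"
      unfolding z_def[symmetric]
    proof (rule prekopa_leindler_interval[where \<alpha>="\<alpha> i" and \<beta>="\<beta> i"])
      show "F (x(i := t)) = 0" if "t < \<alpha> i" for t
        using that xy by (intro insert(7) upd) auto
      show "G (y(i := t)) = 0" if "t < \<beta> i" for t
        using that xy by (intro insert(9) upd) auto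
      show "F (x(i := t)) \<le> F (x(i := s))" if "\<alpha> i \<le> s" "s \<le> t" for s t
        using that xy by (intro insert(8) upd) auto
      show "G (y(i := t)) \<le> G (y(i := s))" if "\<beta> i \<le> s" "s \<le> t" for s t
        using that xy by (intro insert(10) upd) auto
      show "F (x(i := s)) * G (y(i := t)) \<le> (H (z(i := (s + t) / 2)))\<^sup>2" if "\<alpha> i \<le> s" "\<beta> i \<le> t" for s t
        unfolding mid[symmetric] using that xy by (intro insert(11) upd) auto
    qed (use xy z insert(4,5,6) in \<open>auto intro!: sect\<close>)
  qed
qed

section \<open>Tails of logconcave distributions\<close>

text \<open>The contraction by h / r carries [0, r) onto [0, h) and moves every point to one where
  \<open>g\<close> is at least as large; the factor h / r is its Jacobian.\<close>

lemma antimono_initial_mass: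
  fixes g :: "real \<Rightarrow> ennreal"
  assumes [measurable]: "g \<in> borel_measurable borel"
    and zero: "\<And>t. t < 0 \<Longrightarrow> g t = 0" and antimono: "\<And>s t. 0 \<le> s \<Longrightarrow> s \<le> t \<Longrightarrow> g t \<le> g s"
    and hr: "0 < h" "h \<le> r"
  shows "ennreal (h / r) * (\<integral>\<^sup>+t. g t * indicator {..<r} t \<partial>lborel) \<le> (\<integral>\<^sup>+t. g t * indicator {..<h} t \<partial>lborel)"
proof -
  have "g t * indicator {..<r} t \<le> g (h / r * t) * indicator {..<h} (h / r * t)" for t
  proof (cases "0 \<le> t \<and> t < r")
    case True
    have "h / r * t \<le> t" using True hr by (intro mult_left_le_one_le) (auto simp: field_simps)
    then show ?thesis using True hr by (auto simp: indicator_def field_simps intro!: antimono)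
  next
    case False
    then show ?thesis using zero[of t] by (auto simp: indicator_def not_le)
  qed
  then have "ennreal (h / r) * (\<integral>\<^sup>+t. g t * indicator {..<r} t \<partial>lborel)
      \<le> ennreal (h / r) * (\<integral>\<^sup>+t. g (0 + h / r * t) * indicator {..<h} (0 + h / r * t) \<partial>lborel)"
    by (intro mult_left_mono nn_integral_mono) auto
  also have "\<dots> = (\<integral>\<^sup>+t. g t * indicator {..<h} t \<partial>lborel)"
    using hr by (subst (2) nn_integral_real_affine[where c="h / r" and t=0]) auto
  finally show ?thesis .
qed

locale logconcave_distribution = prob_space F for F :: "('i \<Rightarrow> real) measure" +
  fixes I :: "'i set" and f :: "('i \<Rightarrow> real) \<Rightarrow> real"
  assumes finite_I: "finite I" and density: "has_density I F f"
    and logconcave: "logconcave I f" and down_monotone: "down_monotone I f"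
begin

lemma sets_F[measurable_cong]: "sets F = sets (Pi\<^sub>M I (\<lambda>_. lborel))"
  and space_F: "space F = I \<rightarrow>\<^sub>E UNIV"
  and f_measurable[measurable]: "f \<in> borel_measurable (Pi\<^sub>M I (\<lambda>_. lborel))"
  using density unfolding has_density_def by (auto simp: space_PiM)

lemma f_nonneg: "x \<in> I \<rightarrow>\<^sub>E UNIV \<Longrightarrow> 0 \<le> f x"
  using logconcave unfolding logconcave_def by blast

lemma f_zero: "x \<in> I \<rightarrow>\<^sub>E UNIV \<Longrightarrow> \<exists>i\<in>I. x i < 0 \<Longrightarrow> f x = 0"
  using down_monotone unfolding down_monotone_def supported_in_orthant_def by blast

lemma f_antimono:
  assumes "x \<in> I \<rightarrow>\<^sub>E UNIV" "y \<in> I \<rightarrow>\<^sub>E UNIV" "\<forall>i\<in>I. 0 \<le> x i \<and> x i \<le> y i"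
  shows "f y \<le> f x"
proof -
  have "x \<in> I \<rightarrow>\<^sub>E {0..}" "y \<in> I \<rightarrow>\<^sub>E {0..}" using assms by (auto simp: PiE_iff intro: order_trans)
  then show ?thesis using assms(3) down_monotone unfolding down_monotone_def by blast
qed

lemma f_midpoint:
  assumes "x \<in> I \<rightarrow>\<^sub>E UNIV" "y \<in> I \<rightarrow>\<^sub>E UNIV"
  shows "f x * f y \<le> (f (\<lambda>i\<in>I. (x i + y i) / 2))\<^sup>2"
proof -
  have nn: "0 \<le> f x" "0 \<le> f y" using assms f_nonneg by auto
  have "f x powr (1/2) * f y powr (1 - 1/2) \<le> f (\<lambda>i\<in>I. 1/2 * x i + (1 - 1/2) * y i)"
    using logconcave[unfolded logconcave_def, THEN conjunct2, rule_format, OF assms, of "1/2"] by simp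
  also have "(\<lambda>i\<in>I. 1/2 * x i + (1 - 1/2) * y i) = (\<lambda>i\<in>I. (x i + y i) / 2)"
    by (auto simp: fun_eq_iff restrict_def field_simps)
  finally have "sqrt (f x) * sqrt (f y) \<le> f (\<lambda>i\<in>I. (x i + y i) / 2)"
    using nn by (simp add: powr_half_sqrt restrict_def)
  then have "(sqrt (f x) * sqrt (f y))\<^sup>2 \<le> (f (\<lambda>i\<in>I. (x i + y i) / 2))\<^sup>2"
    using nn by (intro power_mono) auto
  then show ?thesis using nn by (simp add: power_mult_distrib)
qed

lemma emeasure_F: "A \<in> sets F \<Longrightarrow> emeasure F A = (\<integral>\<^sup>+x. ennreal (f x) * indicator A x \<partial>Pi\<^sub>M I (\<lambda>_. lborel))"
  using density unfolding has_density_def by (auto simp: emeasure_density)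

lemma nn_integral_f: "(\<integral>\<^sup>+x. ennreal (f x) \<partial>Pi\<^sub>M I (\<lambda>_. lborel)) = 1"
proof -
  have "(\<integral>\<^sup>+x. ennreal (f x) \<partial>Pi\<^sub>M I (\<lambda>_. lborel)) = (\<integral>\<^sup>+x. ennreal (f x) * indicator (space F) x \<partial>Pi\<^sub>M I (\<lambda>_. lborel))"
    by (rule nn_integral_cong) (simp add: space_F space_PiM)
  then show ?thesis using emeasure_F[OF sets.top] emeasure_space_1 by simp
qed

section \<open>Tails under doubling of the threshold\<close>

definition tail :: "'i set \<Rightarrow> real \<Rightarrow> ('i \<Rightarrow> real) set" where
  "tail S t = {x \<in> space F. \<forall>e\<in>S. t \<le> x e}"

lemma component_measurable: "e \<in> I \<Longrightarrow> (\<lambda>x. x e) \<in> borel_measurable F"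
  by (metis measurable_component_singleton measurable_cong_sets sets_F sets_lborel)

lemma tail_sets[measurable]: "S \<subseteq> I \<Longrightarrow> tail S t \<in> sets F"
proof -
  assume S: "S \<subseteq> I"
  then have "finite S" using finite_I finite_subset by blast
  moreover have [measurable]: "(\<lambda>x. x e) \<in> borel_measurable F" if "e \<in> S" for e
    using that S component_measurable by auto
  ultimately show ?thesis unfolding tail_def by measurable
qed

text \<open>The midpoint of a point of the orthant and a point of \<open>tail S (2 * h)\<close> lies
  in \<open>tail S h\<close>. Prekopa-Leindler is applied to \<open>f\<close> and its restrictions
  to the two tails; the unrestricted \<open>f\<close> has integral 1 and disappears.\<close>

lemma tail_double:
  assumes S: "S \<subseteq> I" and h: "0 \<le> h"
  shows "prob (tail S (2 * h)) \<le> (prob (tail S h))\<^sup>2"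
proof -
  have [measurable]: "tail S t \<in> sets (Pi\<^sub>M I (\<lambda>_. lborel))" for t
    using tail_sets[OF S] sets_F by simp
  have "(\<integral>\<^sup>+x. ennreal (f x) \<partial>Pi\<^sub>M I (\<lambda>_. lborel))
      * (\<integral>\<^sup>+x. ennreal (f x) * indicator (tail S (2 * h)) x \<partial>Pi\<^sub>M I (\<lambda>_. lborel))
    \<le> (\<integral>\<^sup>+x. ennreal (f x) * indicator (tail S h) x \<partial>Pi\<^sub>M I (\<lambda>_. lborel))\<^sup>2"
  proof (rule prekopa_leindler_antimono[OF finite_I, where \<alpha>="\<lambda>_. 0" and \<beta>="\<lambda>i. if i \<in> S then 2 * h else 0"])
    fix x :: "'i \<Rightarrow> real" assume x: "x \<in> I \<rightarrow>\<^sub>E UNIV" "\<exists>i\<in>I. x i < (if i \<in> S then 2 * h else 0)"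
    then obtain i where i: "i \<in> I" "x i < (if i \<in> S then 2 * h else 0)" by blast
    show "ennreal (f x) * indicator (tail S (2 * h)) x = 0"
    proof (cases "i \<in> S")
      case True
      then show ?thesis using i by (force simp: tail_def indicator_def)
    next
      case False
      then have "f x = 0" using i x by (intro f_zero) auto
      then show ?thesis by simp
    qed
  next
    fix x y :: "'i \<Rightarrow> real"
    assume xy: "x \<in> I \<rightarrow>\<^sub>E UNIV" "y \<in> I \<rightarrow>\<^sub>E UNIV" "\<forall>i\<in>I. (if i \<in> S then 2 * h else 0) \<le> x i \<and> x i \<le> y i"
    have "f y \<le> f x" using xy h by (intro f_antimono) (auto split: if_splits intro: order_trans[of _ "2 * h"])
    moreover have "x \<in> tail S (2 * h)" using xy S by (fastforce simp: tail_def space_F subset_iff)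
    ultimately show "ennreal (f y) * indicator (tail S (2 * h)) y \<le> ennreal (f x) * indicator (tail S (2 * h)) x"
      by (intro mult_mono ennreal_leI) (auto simp: indicator_def)
  next
    fix x y :: "'i \<Rightarrow> real"
    assume xy: "x \<in> I \<rightarrow>\<^sub>E UNIV" "y \<in> I \<rightarrow>\<^sub>E UNIV" "\<forall>i\<in>I. 0 \<le> x i"
      "\<forall>i\<in>I. (if i \<in> S then 2 * h else 0) \<le> y i"
    have "(\<lambda>i\<in>I. (x i + y i) / 2) \<in> tail S h"
      unfolding tail_def space_F using xy S by (force simp: subset_iff)
    moreover have "ennreal (f x * f y) \<le> ennreal ((f (\<lambda>i\<in>I. (x i + y i) / 2))\<^sup>2)"
      using f_midpoint xy by (intro ennreal_leI) auto
    ultimately show "ennreal (f x) * (ennreal (f y) * indicator (tail S (2 * h)) y)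
      \<le> (ennreal (f (\<lambda>i\<in>I. (x i + y i) / 2)) * indicator (tail S h) (\<lambda>i\<in>I. (x i + y i) / 2))\<^sup>2"
      using xy f_nonneg by (auto simp: indicator_def ennreal_mult ennreal_power)
  qed (auto simp: f_zero intro!: ennreal_leI f_antimono)
  then have "emeasure F (tail S (2 * h)) \<le> (emeasure F (tail S h))\<^sup>2"
    by (simp add: nn_integral_f emeasure_F[OF tail_sets[OF S]])
  then show ?thesis
    by (simp add: emeasure_eq_measure ennreal_power)
qed

lemma tail_power:
  assumes S: "S \<subseteq> I" and h: "0 \<le> h"
  shows "prob (tail S (2 ^ j * h)) \<le> prob (tail S h) ^ (2 ^ j)"
proof (induction j)
  case (Suc j)
  have "prob (tail S (2 ^ Suc j * h)) \<le> (prob (tail S (2 ^ j * h)))\<^sup>2"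
    using tail_double[OF S, of "2 ^ j * h"] h by (simp add: mult_ac)
  also have "\<dots> \<le> (prob (tail S h) ^ (2 ^ j))\<^sup>2" using Suc by (intro power_mono) auto
  finally show ?case by (simp add: power_mult[symmetric] mult_ac)
qed simp

text \<open>Fubini in the coordinate \<open>e\<close>: as \<open>e \<notin> S\<close>, the condition
  \<open>tail S s\<close> is constant along each line in this direction, and on the line the density
  is antimonotone.\<close>

lemma initial_mass:
  assumes e: "e \<in> I" and S: "S \<subseteq> I" "e \<notin> S" and hr: "0 < h" "h \<le> r"
  shows "h / r * prob ({x \<in> space F. x e < r} \<inter> tail S s) \<le> prob ({x \<in> space F. x e < h} \<inter> tail S s)"
proof -
  interpret product_sigma_finite "\<lambda>_::'i. lborel :: real measure" by standard
  define J where "J = I - {e}"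
  have J: "I = insert e J" "finite J" "e \<notin> J" using e finite_I by (auto simp: J_def)
  have [measurable]: "(\<lambda>x. x e) \<in> borel_measurable F" by (rule component_measurable[OF e])
  have A[measurable]: "{x \<in> space F. x e < t} \<inter> tail S s \<in> sets F" for t
    using S(1) by measurable
  have meas: "(\<lambda>x. ennreal (f x) * indicator ({x \<in> space F. x e < t} \<inter> tail S s) x) \<in> borel_measurable (Pi\<^sub>M (insert e J) (\<lambda>_. lborel))" for t
    using A[of t] unfolding sets_F J(1)[symmetric] by measurable
  have upd: "x(e := t) \<in> I \<rightarrow>\<^sub>E UNIV" if "x \<in> J \<rightarrow>\<^sub>E UNIV" for x :: "'i \<Rightarrow> real" and t
    using that J by (auto simp: PiE_iff extensional_def)
  have ind: "indicator ({x \<in> space F. x e < t} \<inter> tail S s) (x(e := y)) = indicator {..<t} y * (indicator (tail S s) (x(e := 0)) :: ennreal)"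
    if "x \<in> J \<rightarrow>\<^sub>E UNIV" for x t y
    using upd[OF that] S by (auto simp: indicator_def tail_def space_F)
  \<comment> \<open>The value 0 inserted at \<open>e\<close> is arbitrary, because
    \<open>tail S s\<close> does not look at this coordinate.\<close>
  define g where "g x y = ennreal (f (x(e := y))) * indicator (tail S s) (x(e := 0))" for x y
  define K where "K t x = (\<integral>\<^sup>+y. ennreal (f (x(e := y))) * indicator ({x \<in> space F. x e < t} \<inter> tail S s) (x(e := y)) \<partial>lborel)" for t x
  have K_meas[measurable]: "K t \<in> borel_measurable (Pi\<^sub>M J (\<lambda>_. lborel))" for t
    using meas[of t] unfolding K_def by measurable
  have K_g: "K t x = (\<integral>\<^sup>+y. g x y * indicator {..<t} y \<partial>lborel)" if "x \<in> J \<rightarrow>\<^sub>E UNIV" for t x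
    unfolding K_def using that by (intro nn_integral_cong) (simp add: ind g_def mult_ac)
  have eq: "emeasure F ({x \<in> space F. x e < t} \<inter> tail S s) = (\<integral>\<^sup>+x. K t x \<partial>Pi\<^sub>M J (\<lambda>_. lborel))" for t
    using emeasure_F[OF A, of t] product_nn_integral_insert[OF J(2,3) meas] J(1) by (simp add: K_def)
  have gm: "g x \<in> borel_measurable borel" if "x \<in> J \<rightarrow>\<^sub>E UNIV" for x
  proof -
    have [measurable]: "(\<lambda>y. f (x(e := y))) \<in> borel_measurable borel"
      using measurable_comp[OF measurable_component_update f_measurable[unfolded J(1)], of x] that J(3)
      by (simp add: comp_def space_PiM fun_upd_def)
    show ?thesis unfolding g_def by measurable
  qed
  have inner: "ennreal (h / r) * (\<integral>\<^sup>+y. g x y * indicator {..<r} y \<partial>lborel) \<le> (\<integral>\<^sup>+y. g x y * indicator {..<h} y \<partial>lborel)"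
    if x: "x \<in> J \<rightarrow>\<^sub>E UNIV" for x
  proof (rule antimono_initial_mass[OF gm[OF x] _ _ hr])
    show "g x t = 0" if "t < 0" for t
      using f_zero[OF upd[OF x, of t], OF bexI[OF _ e]] that by (simp add: g_def)
    show "g x t \<le> g x u" if ut: "0 \<le> u" "u \<le> t" for u t
    proof (cases "\<exists>i\<in>J. x i < 0")
      case True
      then have "\<exists>i\<in>I. (x(e := v)) i < 0" for v using J by auto
      then show ?thesis using f_zero[OF upd[OF x]] by (simp add: g_def)
    next
      case False
      then have "f (x(e := t)) \<le> f (x(e := u))"
        using ut J by (intro f_antimono upd x) (auto simp: not_less)
      then show ?thesis unfolding g_def by (intro mult_right_mono ennreal_leI) auto
    qed
  qed
  have "ennreal (h / r) * emeasure F ({x \<in> space F. x e < r} \<inter> tail S s)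
     = (\<integral>\<^sup>+x. ennreal (h / r) * K r x \<partial>Pi\<^sub>M J (\<lambda>_. lborel))"
    unfolding eq by (rule nn_integral_cmult[symmetric]) measurable
  also have "\<dots> \<le> emeasure F ({x \<in> space F. x e < h} \<inter> tail S s)"
    unfolding eq by (intro nn_integral_mono) (simp add: space_PiM K_g inner)
  finally have "ennreal (h / r * prob ({x \<in> space F. x e < r} \<inter> tail S s)) \<le> ennreal (prob ({x \<in> space F. x e < h} \<inter> tail S s))"
    using hr by (subst ennreal_mult) (auto simp: emeasure_eq_measure)
  then show ?thesis by simp
qed

end

section \<open>Second moments and the exponential tail bound\<close>

context logconcave_distribution
begin

text \<open>The support condition excludes only negative coordinates; a coordinate equal to 0 has
  probability 0 since a point is a Lebesgue null set on each line.\<close>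

lemma AE_component_pos:
  assumes e: "e \<in> I"
  shows "AE x in F. 0 < x e"
proof -
  interpret product_sigma_finite "\<lambda>_::'i. lborel :: real measure" by standard
  define J where "J = I - {e}"
  have J: "I = insert e J" "finite J" "e \<notin> J" using e finite_I by (auto simp: J_def)
  have [measurable]: "(\<lambda>x. x e) \<in> borel_measurable F" by (rule component_measurable[OF e])
  have A[measurable]: "{x \<in> space F. x e \<le> 0} \<in> sets F" by measurable
  have meas: "(\<lambda>x. ennreal (f x) * indicator {x \<in> space F. x e \<le> 0} x) \<in> borel_measurable (Pi\<^sub>M (insert e J) (\<lambda>_. lborel))"
    using A unfolding sets_F J(1)[symmetric] by measurable
  have upd: "x(e := t) \<in> I \<rightarrow>\<^sub>E UNIV" if "x \<in> J \<rightarrow>\<^sub>E UNIV" for x :: "'i \<Rightarrow> real" and t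
    using that J by (auto simp: PiE_iff extensional_def)
  have "emeasure F {x \<in> space F. x e \<le> 0}
      = (\<integral>\<^sup>+x. ennreal (f x) * indicator {x \<in> space F. x e \<le> 0} x \<partial>Pi\<^sub>M (insert e J) (\<lambda>_. lborel))"
    using emeasure_F[OF A] J(1) by simp
  also have "\<dots> = (\<integral>\<^sup>+x. (\<integral>\<^sup>+y. ennreal (f (x(e := y))) * indicator {x \<in> space F. x e \<le> 0} (x(e := y)) \<partial>lborel) \<partial>Pi\<^sub>M J (\<lambda>_. lborel))"
    by (rule product_nn_integral_insert[OF J(2,3) meas])
  also have "\<dots> = (\<integral>\<^sup>+x. 0 \<partial>Pi\<^sub>M J (\<lambda>_. lborel :: real measure))"
  proof (rule nn_integral_cong)
    fix x :: "'i \<Rightarrow> real" assume "x \<in> space (Pi\<^sub>M J (\<lambda>_. lborel))"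
    then have x: "x \<in> J \<rightarrow>\<^sub>E UNIV" by (simp add: space_PiM)
    have "AE y in lborel. ennreal (f (x(e := y))) * indicator {x \<in> space F. x e \<le> 0} (x(e := y)) = 0"
      using AE_lborel_singleton[of 0]
    proof eventually_elim
      case (elim y)
      then show ?case
        using f_zero[OF upd[OF x, of y], OF bexI[OF _ e]] by (cases "y < 0") (auto simp: indicator_def)
    qed
    then show "(\<integral>\<^sup>+y. ennreal (f (x(e := y))) * indicator {x \<in> space F. x e \<le> 0} (x(e := y)) \<partial>lborel) = 0"
      by (subst nn_integral_cong_AE[where v="\<lambda>_. 0"]) auto
  qed
  finally have "emeasure F {x \<in> space F. \<not> 0 < x e} = 0" by (simp add: not_less)
  then show ?thesis by (intro AE_I[of _ _ "{x \<in> space F. \<not> 0 < x e}"]) auto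
qed

lemma tail_decseq_limit:
  assumes S: "S \<subseteq> I" "S \<noteq> {}"
  shows "(\<lambda>n. prob (tail S (real n))) \<longlonglongrightarrow> 0"
proof -
  have "(\<lambda>n. prob (tail S (real n))) \<longlonglongrightarrow> prob (\<Inter>n. tail S (real n))"
    by (rule finite_Lim_measure_decseq) (use S tail_sets[OF S(1)] in \<open>auto simp: decseq_def tail_def intro: order_trans\<close>)
  moreover have "(\<Inter>n. tail S (real n)) = {}"
  proof -
    obtain e where e: "e \<in> S" using S by blast
    have "x \<notin> (\<Inter>n. tail S (real n))" for x
    proof
      assume "x \<in> (\<Inter>n. tail S (real n))"
      then have "real n \<le> x e" for n using e by (auto simp: tail_def)
      then show False using reals_Archimedean2[of "x e"] by (meson not_less)
    qed
    then show ?thesis by blast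
  qed
  ultimately show ?thesis by simp
qed

text \<open>This supplies the scale at which the decay argument starts: for small \<open>h\<close>
  almost all mass has every coordinate above \<open>h\<close>. The scales p / 2^j are those from
  which repeated doubling returns to p.\<close>

lemma tail_near_zero:
  assumes "0 \<le> p"
  shows "(\<lambda>j. prob (tail I (p / 2 ^ j))) \<longlonglongrightarrow> 1"
proof -
  have "(\<lambda>j. prob (tail I (p / 2 ^ j))) \<longlonglongrightarrow> prob (\<Union>j. tail I (p / 2 ^ j))"
  proof (rule finite_Lim_measure_incseq)
    have "p / 2 ^ n \<le> p / 2 ^ m" if "m \<le> n" for m n :: nat
      using assms that by (intro divide_left_mono) auto
    then show "incseq (\<lambda>j. tail I (p / 2 ^ j))"
      by (auto simp: incseq_def tail_def intro: order_trans)
  qed auto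
  moreover have "prob (\<Union>j. tail I (p / 2 ^ j)) = 1"
  proof (rule prob_eq_1[THEN iffD2])
    have "AE x in F. \<forall>e\<in>I. 0 < x e"
      using finite_I AE_component_pos by (auto intro: AE_finite_allI)
    then show "AE x in F. x \<in> (\<Union>j. tail I (p / 2 ^ j))"
      using AE_space
    proof eventually_elim
      case (elim x)
      have "(\<lambda>j. p * (1 / 2) ^ j) \<longlonglongrightarrow> p * 0" by (intro tendsto_intros LIMSEQ_realpow_zero) auto
      then have lim: "(\<lambda>j. p / 2 ^ j) \<longlonglongrightarrow> 0" by (simp add: power_one_over field_simps)
      have "\<forall>\<^sub>F j in sequentially. \<forall>e\<in>I. p / 2 ^ j < x e"
        using finite_I elim(1) by (auto intro!: eventually_ball_finite order_tendstoD(2)[OF lim])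
      then obtain j where "\<forall>e\<in>I. p / 2 ^ j < x e"
        using eventually_happens'[OF sequentially_bot] by blast
      then have "x \<in> tail I (p / 2 ^ j)" using elim(2) by (auto simp: tail_def less_imp_le)
      then show ?case by blast
    qed
  qed auto
  ultimately show ?thesis by simp
qed

text \<open>Without integrability the Bochner integral in \<^const>\<open>sigma\<close> would be the junk value \<open>0\<close>.\<close>

lemma integrable_square:
  assumes e: "e \<in> I"
  shows "integrable F (\<lambda>x. (x e)\<^sup>2)"
proof -
  have [measurable]: "(\<lambda>x. x e) \<in> borel_measurable F" by (rule component_measurable[OF e])
  have E: "{e} \<subseteq> I" using e by simp
  have [measurable]: "tail {e} t \<in> sets F" for t by (rule tail_sets[OF E])
  \<comment> \<open>The value 1 / 16 has to beat the factor 4 by which squares grow at each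
    doubling: the resulting series has ratio 4 * (1 / 16) = 1 / 4.\<close>
  have "\<forall>\<^sub>F n in sequentially. prob (tail {e} (real n)) < 1 / 16"
    by (rule order_tendstoD(2)[OF tail_decseq_limit]) (use e in auto)
  then have "\<forall>\<^sub>F n in sequentially. prob (tail {e} (real n)) < 1 / 16 \<and> 0 < n"
    using eventually_gt_at_top[of 0] by (rule eventually_conj)
  then obtain n where n: "prob (tail {e} (real n)) < 1 / 16" "0 < n"
    using eventually_happens'[OF sequentially_bot] by blast
  define h where "h = real n"
  have h: "0 < h" "prob (tail {e} h) \<le> 1 / 16" using n by (auto simp: h_def)
  have tail_le: "prob (tail {e} (2 ^ j * h)) \<le> (1 / 16) ^ Suc j" for j
  proof -
    have "prob (tail {e} (2 ^ j * h)) \<le> prob (tail {e} h) ^ (2 ^ j)"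
      using h by (intro tail_power E) auto
    also have "\<dots> \<le> (1 / 16) ^ (2 ^ j)" using h by (intro power_mono) auto
    also have "\<dots> \<le> (1 / 16) ^ Suc j"
      by (intro power_decreasing) (auto simp: Suc_le_eq)
    finally show ?thesis .
  qed
  \<comment> \<open>A value of at least \<open>h\<close> lies in [2^j h, 2^(j+1) h) for some
    \<open>j\<close>, and the \<open>j\<close>-th summand alone dominates its square.\<close>
  have dyadic: "ennreal ((x e)\<^sup>2) \<le> ennreal (h\<^sup>2) + (\<Sum>j. ennreal (4 ^ Suc j * h\<^sup>2) * indicator (tail {e} (2 ^ j * h)) x)"
    if x: "x \<in> space F" "0 < x e" for x
  proof (cases "x e < h")
    case True
    then have "(x e)\<^sup>2 \<le> h\<^sup>2" using x by (intro power_mono) auto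
    then show ?thesis by (intro add_increasing2) (auto intro: ennreal_leI)
  next
    case False
    obtain j0 where "x e / h < 2 ^ j0" using real_arch_pow[of 2 "x e / h"] by auto
    then have ex: "\<exists>j. x e < 2 ^ j * h" using h by (auto simp: field_simps)
    define k where "k = (LEAST j. x e < 2 ^ j * h)"
    have k: "x e < 2 ^ k * h" unfolding k_def by (rule LeastI_ex[OF ex])
    with False have "k \<noteq> 0" by (intro notI) simp
    then obtain j where j: "k = Suc j" by (meson not0_implies_Suc)
    have "\<not> x e < 2 ^ j * h" using not_less_Least[of j "\<lambda>j. x e < 2 ^ j * h"] j by (simp add: k_def)
    then have "x \<in> tail {e} (2 ^ j * h)" using x by (auto simp: tail_def)
    moreover have "(x e)\<^sup>2 \<le> (2 ^ k * h)\<^sup>2" using k x by (intro power_mono) auto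
    moreover have "(2 ^ k * h)\<^sup>2 = 4 ^ Suc j * h\<^sup>2"
    proof -
      have "((2::real) ^ k)\<^sup>2 = (2\<^sup>2) ^ k" by (simp only: power_mult[symmetric] mult.commute)
      then show ?thesis by (simp add: j power_mult_distrib)
    qed
    ultimately have "ennreal ((x e)\<^sup>2) \<le> ennreal (4 ^ Suc j * h\<^sup>2) * indicator (tail {e} (2 ^ j * h)) x"
      by (simp add: ennreal_leI)
    also have "\<dots> = (\<Sum>i\<in>{j}. ennreal (4 ^ Suc i * h\<^sup>2) * indicator (tail {e} (2 ^ i * h)) x)"
      by (simp only: sum.insert sum.empty finite.emptyI empty_iff not_False_eq_True add_0_right)
    also have "\<dots> \<le> (\<Sum>j. ennreal (4 ^ Suc j * h\<^sup>2) * indicator (tail {e} (2 ^ j * h)) x)"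
      by (rule sum_le_suminf) auto
    finally show ?thesis by (simp add: add_increasing)
  qed
  have "(\<integral>\<^sup>+x. ennreal ((x e)\<^sup>2) \<partial>F)
      \<le> (\<integral>\<^sup>+x. ennreal (h\<^sup>2) + (\<Sum>j. ennreal (4 ^ Suc j * h\<^sup>2) * indicator (tail {e} (2 ^ j * h)) x) \<partial>F)"
  proof (rule nn_integral_mono_AE)
    show "AE x in F. ennreal ((x e)\<^sup>2) \<le> ennreal (h\<^sup>2) + (\<Sum>j. ennreal (4 ^ Suc j * h\<^sup>2) * indicator (tail {e} (2 ^ j * h)) x)"
      using AE_space AE_component_pos[OF e] by eventually_elim (rule dyadic)
  qed
  also have "\<dots> = ennreal (h\<^sup>2) + (\<Sum>j. ennreal (4 ^ Suc j * h\<^sup>2) * emeasure F (tail {e} (2 ^ j * h)))"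
    by (simp add: nn_integral_add nn_integral_suminf nn_integral_cmult emeasure_space_1)
  also have "\<dots> \<le> ennreal (h\<^sup>2) + (\<Sum>j. ennreal (h\<^sup>2 * (1 / 4) ^ Suc j))"
  proof (intro add_left_mono suminf_le)
    fix j
    have "4 ^ Suc j * h\<^sup>2 * prob (tail {e} (2 ^ j * h)) \<le> 4 ^ Suc j * h\<^sup>2 * (1 / 16) ^ Suc j"
      by (intro mult_left_mono tail_le) auto
    also have "\<dots> = h\<^sup>2 * (4 * (1 / 16)) ^ Suc j" unfolding power_mult_distrib by simp
    finally have "4 ^ Suc j * h\<^sup>2 * prob (tail {e} (2 ^ j * h)) \<le> h\<^sup>2 * (1 / 4) ^ Suc j" by simp
    then show "ennreal (4 ^ Suc j * h\<^sup>2) * emeasure F (tail {e} (2 ^ j * h)) \<le> ennreal (h\<^sup>2 * (1 / 4) ^ Suc j)"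
      by (simp add: emeasure_eq_measure ennreal_mult[symmetric] ennreal_leI)
  qed auto
  also have "\<dots> < \<infinity>"
  proof -
    have "summable (\<lambda>j. h\<^sup>2 * (1 / 4) ^ Suc j)"
      by (intro summable_mult, subst summable_Suc_iff) (auto intro: summable_geometric)
    then show ?thesis by (simp add: suminf_ennreal_eq[OF _ summable_sums] less_top[symmetric])
  qed
  finally show ?thesis
    by (intro integrableI_bounded) auto
qed

lemma sigma_pos:
  assumes e: "e \<in> I"
  shows "0 < sigma F e"
proof -
  have "(\<integral>x. (x e)\<^sup>2 \<partial>F) \<noteq> 0"
  proof
    assume "(\<integral>x. (x e)\<^sup>2 \<partial>F) = 0"
    then have "AE x in F. (x e)\<^sup>2 = 0"
      using integral_nonneg_eq_0_iff_AE[OF integrable_square[OF e]] by auto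
    with AE_component_pos[OF e] have "AE x in F. False" by eventually_elim auto
    then show False by simp
  qed
  moreover have "0 \<le> (\<integral>x. (x e)\<^sup>2 \<partial>F)" by simp
  ultimately show ?thesis by (auto simp: sigma_def less_le)
qed

text \<open>Chebyshev's inequality at two standard units. Any common upper bound \<open>s\<close> is
  allowed, so that one value serves all coordinates.\<close>

lemma mass_below_two_sigma:
  assumes e: "e \<in> I" and s: "sigma F e \<le> s"
  shows "3 / 4 \<le> prob {x \<in> space F. x e < 2 * s}"
proof -
  have [measurable]: "(\<lambda>x. x e) \<in> borel_measurable F" by (rule component_measurable[OF e])
  have s0: "0 < s" using sigma_pos[OF e] s by simp
  have "prob {x \<in> space F. (2 * s)\<^sup>2 \<le> (x e)\<^sup>2} \<le> (\<integral>x. (x e)\<^sup>2 \<partial>F) / (2 * s)\<^sup>2"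
    using s0 by (intro integral_Markov_inequality_measure integrable_square e) auto
  also have "(\<integral>x. (x e)\<^sup>2 \<partial>F) = (sigma F e)\<^sup>2" by (simp add: sigma_def)
  also have "(sigma F e)\<^sup>2 / (2 * s)\<^sup>2 \<le> s\<^sup>2 / (2 * s)\<^sup>2"
    using s sigma_pos[OF e] by (intro divide_right_mono power_mono) auto
  also have "\<dots> = 1 / 4" using s0 by (simp add: power2_eq_square)
  finally have le: "prob {x \<in> space F. (2 * s)\<^sup>2 \<le> (x e)\<^sup>2} \<le> 1 / 4" .
  have "1 - prob {x \<in> space F. x e < 2 * s} = prob (space F - {x \<in> space F. x e < 2 * s})"
    by (rule prob_compl[symmetric]) measurable
  also have "\<dots> \<le> prob {x \<in> space F. (2 * s)\<^sup>2 \<le> (x e)\<^sup>2}"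
  proof (rule finite_measure_mono)
    have "(2 * s)\<^sup>2 \<le> t\<^sup>2" if "2 * s \<le> t" for t using that s0 by (intro power_mono) auto
    then show "space F - {x \<in> space F. x e < 2 * s} \<subseteq> {x \<in> space F. (2 * s)\<^sup>2 \<le> (x e)\<^sup>2}"
      by (auto simp: not_less simp del: power_mult_distrib)
  qed measurable
  finally show ?thesis using le by simp
qed

text \<open>Each further coordinate \<open>e\<close> costs at least h / (4 s): the events
  \<open>x e < 2 * s\<close> and \<open>tail I h\<close> have mass 3 / 4 each, so they share mass 1
  / 2, and \<open>initial_mass\<close> puts the fraction h / (2 s) of what lies in
  \<open>tail S h\<close> with \<open>x e < 2 * s\<close> below \<open>x e = h\<close>.\<close>

lemma tail_linear_decay:
  assumes S: "S \<subseteq> I" and s: "\<And>e. e \<in> S \<Longrightarrow> sigma F e \<le> s"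
    and h: "0 < h" "h \<le> 2 * s" "3 / 4 \<le> prob (tail I h)"
  shows "prob (tail S h) \<le> 1 - card S * (h / (4 * s))"
  using finite_subset[OF S finite_I] S s
proof (induction S rule: finite_induct)
  case (insert e S)
  then have e: "e \<in> I" and SI: "S \<subseteq> I" by auto
  have [measurable]: "(\<lambda>x. x e) \<in> borel_measurable F" by (rule component_measurable[OF e])
  have [measurable]: "tail S h \<in> sets F" by (rule tail_sets[OF SI])
  have s0: "0 < s" using sigma_pos[OF e] insert.prems(2)[of e] by simp
  have "1 / 2 \<le> prob {x \<in> space F. x e < 2 * s} + prob (tail I h) - 1"
    using mass_below_two_sigma[OF e insert.prems(2)] h(3) by simp
  also have "\<dots> \<le> prob ({x \<in> space F. x e < 2 * s} \<inter> tail I h)"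
  proof -
    have "prob ({x \<in> space F. x e < 2 * s} \<union> tail I h) \<le> 1" by simp
    moreover have "prob ({x \<in> space F. x e < 2 * s} \<union> tail I h) = prob {x \<in> space F. x e < 2 * s} + prob (tail I h)
      - prob ({x \<in> space F. x e < 2 * s} \<inter> tail I h)"
      by (rule measure_Un3) (auto simp: fmeasurable_eq_sets)
    ultimately show ?thesis by simp
  qed
  also have "\<dots> \<le> prob ({x \<in> space F. x e < 2 * s} \<inter> tail S h)"
    by (intro finite_measure_mono sets.Int \<open>tail S h \<in> sets F\<close>) (use SI in \<open>auto simp: tail_def\<close>)
  finally have "h / (2 * s) * (1 / 2) \<le> h / (2 * s) * prob ({x \<in> space F. x e < 2 * s} \<inter> tail S h)"
    using h s0 by (intro mult_left_mono) auto
  also have "\<dots> \<le> prob ({x \<in> space F. x e < h} \<inter> tail S h)"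
    by (intro initial_mass e SI h insert.hyps)
  finally have "h / (4 * s) \<le> prob ({x \<in> space F. x e < h} \<inter> tail S h)" by (simp add: mult.commute)
  moreover have "prob (tail (insert e S) h) = prob (tail S h - {x \<in> space F. x e < h} \<inter> tail S h)"
    by (rule arg_cong[of _ _ prob]) (auto simp: tail_def)
  moreover have "\<dots> = prob (tail S h) - prob ({x \<in> space F. x e < h} \<inter> tail S h)"
    by (rule finite_measure_Diff) auto
  moreover have "prob (tail S h) \<le> 1 - card S * (h / (4 * s))"
    using insert by auto
  ultimately show ?case using insert.hyps by (simp add: algebra_simps add_divide_distrib)
qed (simp add: tail_def)

text \<open>At the tiny scale h = p / 2^j the linear decay gives exp (- |S| h / (4 s)), and
  \<open>j\<close> doublings raise it to the power 2^j. As 2^j h = p, the result no longer depends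
  on \<open>j\<close>.\<close>

theorem prob_all_components_large:
  assumes S: "S \<subseteq> I" and s: "0 < s" "\<And>e. e \<in> S \<Longrightarrow> sigma F e \<le> s" and p: "0 \<le> p"
  shows "prob {x \<in> space F. \<forall>e\<in>S. p < x e} \<le> exp (- (p / (4 * s)) * card S)"
proof (cases "p = 0")
  case False
  have "\<forall>\<^sub>F j in sequentially. 3 / 4 < prob (tail I (p / 2 ^ j))"
    by (rule order_tendstoD(1)[OF tail_near_zero[OF p]]) simp
  moreover have "(\<lambda>j. p * (1 / 2) ^ j) \<longlonglongrightarrow> p * 0" by (intro tendsto_intros LIMSEQ_realpow_zero) auto
  then have "\<forall>\<^sub>F j in sequentially. p * (1 / 2) ^ j < 2 * s"
    using s by (intro order_tendstoD(2)) auto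
  ultimately have "\<forall>\<^sub>F j in sequentially. 3 / 4 < prob (tail I (p / 2 ^ j)) \<and> p * (1 / 2) ^ j < 2 * s"
    by (rule eventually_conj)
  then obtain j where j: "3 / 4 < prob (tail I (p / 2 ^ j))" "p * (1 / 2) ^ j < 2 * s"
    using eventually_happens'[OF sequentially_bot] by blast
  define h where "h = p / 2 ^ j"
  have h: "0 < h" "h \<le> 2 * s" "3 / 4 \<le> prob (tail I h)" "p = 2 ^ j * h"
    using j p False by (auto simp: h_def power_one_over field_simps)
  have "prob {x \<in> space F. \<forall>e\<in>S. p < x e} \<le> prob (tail S (2 ^ j * h))"
    by (intro finite_measure_mono tail_sets S) (auto simp: tail_def h(4) less_imp_le)
  also have "\<dots> \<le> prob (tail S h) ^ (2 ^ j)" using h by (intro tail_power S) auto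
  also have "\<dots> \<le> exp (- (card S * (h / (4 * s)))) ^ (2 ^ j)"
  proof (intro power_mono)
    have "prob (tail S h) \<le> 1 - card S * (h / (4 * s))" by (intro tail_linear_decay S s h)
    also have "\<dots> \<le> exp (- (card S * (h / (4 * s))))"
      using exp_ge_add_one_self[of "- (card S * (h / (4 * s)))"] by simp
    finally show "prob (tail S h) \<le> exp (- (card S * (h / (4 * s))))" .
  qed simp
  also have "\<dots> = exp (- (p / (4 * s)) * card S)"
    by (simp add: h(4) flip: exp_of_nat_mult)
  finally show ?thesis .
qed simp

end

section \<open>Sparse expanders\<close>

text \<open>In a minimal expanding subrelation the tight sets containing a vertex are closed under
  intersection; the smallest one bounds the number of critical arcs leaving that vertex.\<close>

lemma sparse_expanding_subrelation:
  fixes W R :: "('a \<times> 'b) set"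
  assumes fin: "finite W" "finite V" and WV: "W \<subseteq> V \<times> UNIV" and RW: "R \<subseteq> W"
    and small: "\<And>S. S \<subseteq> V \<Longrightarrow> S \<noteq> {} \<Longrightarrow> card S \<le> k \<Longrightarrow> d * card S \<le> card (W `` S)"
    and big: "\<And>S. S \<subseteq> V \<Longrightarrow> k < card S \<Longrightarrow> card S \<le> 2 * k \<Longrightarrow> d * card S \<le> card (R `` S)"
  shows "\<exists>W'. R \<subseteq> W' \<and> W' \<subseteq> W \<and> card W' \<le> card R + d * card V \<and>
     (\<forall>S. S \<subseteq> V \<longrightarrow> S \<noteq> {} \<longrightarrow> card S \<le> k \<longrightarrow> d * card S \<le> card (W' `` S))"
proof -
  define expanding where "expanding W' \<longleftrightarrow> R \<subseteq> W' \<and> W' \<subseteq> W \<and>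
    (\<forall>S. S \<subseteq> V \<longrightarrow> S \<noteq> {} \<longrightarrow> card S \<le> k \<longrightarrow> d * card S \<le> card (W' `` S))" for W'
  have "expanding W" unfolding expanding_def using RW small by auto
  then obtain W' where W': "expanding W'" and minimal: "\<And>W''. expanding W'' \<Longrightarrow> card W' \<le> card W''"
    using ex_has_least_nat[of expanding W card] by blast
  have sub: "R \<subseteq> W'" "W' \<subseteq> W" and exp: "\<And>S. S \<subseteq> V \<Longrightarrow> S \<noteq> {} \<Longrightarrow> card S \<le> k \<Longrightarrow> d * card S \<le> card (W' `` S)"
    using W' unfolding expanding_def by auto
  have finW': "finite W'" using sub fin finite_subset by blast
  have finI: "finite (X `` S)" if "X \<subseteq> W'" for X and S :: "'a set"
    using finite_Image[OF finite_subset[OF that finW']] .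
  have out: "card {u. (v, u) \<in> W' - R} \<le> d" if v: "v \<in> V" for v
  proof (cases "{u. (v, u) \<in> W' - R} = {}")
    case False
    define tight where "tight S \<longleftrightarrow> S \<subseteq> V \<and> v \<in> S \<and> card S \<le> k \<and> card (W' `` S) = d * card S" for S
    have critical: "\<exists>S. tight S \<and> u \<notin> W' `` (S - {v})" if u: "(v, u) \<in> W' - R" for u
    proof -
      \<comment> \<open>By minimality, deleting the arc destroys the expansion of some
        \<open>S\<close>. Since only one neighbour is lost, \<open>S\<close> was tight, and within
        \<open>S\<close> the vertex \<open>u\<close> was reached from \<open>v\<close>
        alone.\<close>
      have "card (W' - {(v, u)}) < card W'" using finW' u by (intro card_Diff1_less) auto
      then have "\<not> expanding (W' - {(v, u)})" using minimal by (meson not_le)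
      then obtain S where S: "S \<subseteq> V" "S \<noteq> {}" "card S \<le> k" "card ((W' - {(v, u)}) `` S) < d * card S"
        using u sub unfolding expanding_def by (auto simp: not_le)
      have ne: "(W' - {(v, u)}) `` S \<noteq> W' `` S" using S exp[OF S(1-3)] by auto
      then have vS: "v \<in> S" by blast
      have "u \<notin> W' `` (S - {v})" using ne by blast
      moreover have "card (W' `` S) \<le> Suc (card ((W' - {(v, u)}) `` S))"
      proof -
        have fin': "finite ((W' - {(v, u)}) `` S)" by (rule finI) auto
        have "card (W' `` S) \<le> card (insert u ((W' - {(v, u)}) `` S))"
          by (rule card_mono) (use fin' in auto)
        also have "\<dots> \<le> Suc (card ((W' - {(v, u)}) `` S))" using fin' by (simp add: card_insert_if)
        finally show ?thesis .
      qed
      with S exp[OF S(1-3)] have "card (W' `` S) = d * card S" by linarith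
      ultimately show ?thesis using S vS unfolding tight_def by blast
    qed
    have inter: "tight (S \<inter> T)" if S: "tight S" and T: "tight T" for S T
    proof -
      have finST: "finite S" "finite T" using S T fin(2) unfolding tight_def by (auto intro: finite_subset)
      have ST: "S \<union> T \<subseteq> V" "S \<union> T \<noteq> {}" "S \<inter> T \<subseteq> V" "S \<inter> T \<noteq> {}" using S T unfolding tight_def by auto
      have cards: "card (S \<union> T) + card (S \<inter> T) = card S + card T"
        using card_Un_Int[OF finST] by simp
      have "card (S \<inter> T) \<le> card S" by (rule card_mono) (use finST in auto)
      then have Ik: "card (S \<inter> T) \<le> k" using S unfolding tight_def by linarith
      \<comment> \<open>The union of two tight sets may have up to \<open>2 * k\<close> elements;
        beyond \<open>k\<close> its expansion comes from \<open>R\<close>. With this lower bound for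
        the union, submodularity of the neighbourhood size forces the intersection to be
        tight.\<close>
      have lowU: "d * card (S \<union> T) \<le> card (W' `` (S \<union> T))"
      proof (cases "card (S \<union> T) \<le> k")
        case False
        have "card (S \<union> T) \<le> 2 * k" using card_Un_le[of S T] S T unfolding tight_def by linarith
        then have "d * card (S \<union> T) \<le> card (R `` (S \<union> T))" using big[OF ST(1)] False by simp
        also have "\<dots> \<le> card (W' `` (S \<union> T))" using sub finI by (intro card_mono) auto
        finally show ?thesis .
      qed (use exp ST in auto)
      have "card (W' `` (S \<inter> T)) \<le> card (W' `` S \<inter> W' `` T)"
        using finI by (intro card_mono) auto
      moreover have "card (W' `` (S \<union> T)) + card (W' `` S \<inter> W' `` T) = card (W' `` S) + card (W' `` T)"
        unfolding Image_Un by (rule card_Un_Int[symmetric]) (auto intro: finI)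
      moreover have "card (W' `` S) + card (W' `` T) = d * card (S \<union> T) + d * card (S \<inter> T)"
      proof -
        have "card (W' `` S) = d * card S" "card (W' `` T) = d * card T" using S T unfolding tight_def by auto
        then show ?thesis using arg_cong[OF cards, of "\<lambda>x. d * x"] by (simp add: add_mult_distrib2)
      qed
      ultimately have "card (W' `` (S \<inter> T)) \<le> d * card (S \<inter> T)" using lowU by linarith
      with exp[OF ST(3,4) Ik] have "card (W' `` (S \<inter> T)) = d * card (S \<inter> T)" by simp
      then show ?thesis using S T Ik unfolding tight_def by auto
    qed
    \<comment> \<open>A tight set of least cardinality lies in every tight set, so each critical
      \<open>u\<close> is a neighbour of \<open>S0\<close> but not of \<open>S0 - {v}\<close>.
      Tightness of \<open>S0\<close> and expansion of \<open>S0 - {v}\<close> leave room for at most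
      \<open>d\<close> of them.\<close>
    obtain S where "tight S" using False critical by blast
    then obtain S0 where S0: "tight S0" and min0: "\<And>T. tight T \<Longrightarrow> card S0 \<le> card T"
      using ex_has_least_nat[of tight S card] by blast
    have fin0: "finite S0" using S0 fin(2) unfolding tight_def by (auto intro: finite_subset)
    have "{u. (v, u) \<in> W' - R} \<subseteq> W' `` S0 - W' `` (S0 - {v})"
    proof
      fix u assume u: "u \<in> {u. (v, u) \<in> W' - R}"
      then obtain T where T: "tight T" "u \<notin> W' `` (T - {v})" using critical by blast
      have "card S0 \<le> card (S0 \<inter> T)" using min0 inter[OF S0 T(1)] by blast
      then have "S0 \<inter> T = S0" using fin0 by (intro card_subset_eq) (auto intro!: antisym card_mono)
      then show "u \<in> W' `` S0 - W' `` (S0 - {v})" using T(2) u S0 unfolding tight_def by blast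
    qed
    then have "card {u. (v, u) \<in> W' - R} \<le> card (W' `` S0 - W' `` (S0 - {v}))"
      using finI by (intro card_mono) auto
    also have "\<dots> = card (W' `` S0) - card (W' `` (S0 - {v}))"
      using finI by (intro card_Diff_subset) auto
    also have "\<dots> \<le> d * card S0 - d * (card S0 - 1)"
    proof -
      have "d * card (S0 - {v}) \<le> card (W' `` (S0 - {v}))"
      proof (cases "S0 - {v} = {}")
        case False
        have "card (S0 - {v}) \<le> card S0" using fin0 by (simp add: card_Diff1_le)
        with S0 False show ?thesis unfolding tight_def by (intro exp) auto
      next
        case True
        then show ?thesis by (simp only: card.empty mult_0_right zero_le)
      qed
      moreover have "card (S0 - {v}) = card S0 - 1" using S0 fin0 unfolding tight_def by (intro card_Diff_singleton) auto
      ultimately have "d * (card S0 - 1) \<le> card (W' `` (S0 - {v}))" by simp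
      then show ?thesis using S0 unfolding tight_def by linarith
    qed
    also have "\<dots> \<le> d" by (cases "card S0") auto
    finally show ?thesis .
  next
    case True
    then show ?thesis by (simp only: card.empty zero_le)
  qed
  have "W' - R = Sigma V (\<lambda>v. {u. (v, u) \<in> W' - R})" using sub WV by auto
  then have "card (W' - R) = card (Sigma V (\<lambda>v. {u. (v, u) \<in> W' - R}))" by (rule arg_cong)
  also have "\<dots> = (\<Sum>v\<in>V. card {u. (v, u) \<in> W' - R})"
  proof (rule card_SigmaI[OF fin(2)], rule ballI)
    fix v
    have "{u. (v, u) \<in> W' - R} \<subseteq> W' `` {v}" by auto
    then show "finite {u. (v, u) \<in> W' - R}" using finI finite_subset by blast
  qed
  also have "\<dots> \<le> of_nat (card V) * d" by (rule sum_bounded_above[OF out])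
  finally have "card (W' - R) \<le> d * card V" by (simp add: mult.commute)
  moreover have "card W' = card R + card (W' - R)"
    using card_Un_disjoint[of R "W' - R"] sub finW' finite_subset[OF sub(1) finW'] by (auto simp: Un_absorb1)
  ultimately show ?thesis using sub exp by (intro exI[of _ W']) auto
qed

section \<open>Graphs as symmetric relations: expansion and connectivity\<close>

definition vpairs :: "'a set \<Rightarrow> 'a set set" where
  "vpairs V = {{u, v} | u v. u \<in> V \<and> v \<in> V \<and> u \<noteq> v}"

definition arcs :: "'a set set \<Rightarrow> ('a \<times> 'a) set" where
  "arcs E = {(u, v). {u, v} \<in> E}"

lemma finite_vpairs: "finite V \<Longrightarrow> finite (vpairs V)"
  by (rule finite_subset[of _ "Pow V"]) (auto simp: vpairs_def)

lemma in_vpairs_iff: "{u, v} \<in> vpairs V \<longleftrightarrow> u \<in> V \<and> v \<in> V \<and> u \<noteq> v"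
  by (auto simp: vpairs_def doubleton_eq_iff)

lemma arcs_commute: "(u, v) \<in> arcs E \<longleftrightarrow> (v, u) \<in> arcs E"
  by (simp add: arcs_def insert_commute)

lemma arcs_subset: "E \<subseteq> vpairs V \<Longrightarrow> arcs E \<subseteq> V \<times> V"
  by (auto simp: arcs_def in_vpairs_iff dest: subsetD)

lemma finite_arcs: "finite V \<Longrightarrow> E \<subseteq> vpairs V \<Longrightarrow> finite (arcs E)"
  by (rule finite_subset[OF arcs_subset]) auto

lemma arcs_mono: "E \<subseteq> E' \<Longrightarrow> arcs E \<subseteq> arcs E'"
  by (auto simp: arcs_def)

lemma card_arcs_le:
  assumes "finite E" "E \<subseteq> vpairs V"
  shows "card (arcs E) \<le> 2 * card E"
proof -
  have "card {(u, v). {u, v} = e} \<le> 2" if "e \<in> E" for e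
  proof -
    obtain a b where e: "e = {a, b}" using \<open>e \<in> E\<close> assms(2) by (auto simp: vpairs_def)
    have "{(u, v). {u, v} = e} \<subseteq> {(a, b), (b, a)}" by (auto simp: e doubleton_eq_iff)
    then have "card {(u, v). {u, v} = e} \<le> card {(a, b), (b, a)}" by (intro card_mono) auto
    also have "\<dots> \<le> 2" by (cases "a = b") auto
    finally show ?thesis .
  qed
  then have "(\<Sum>e\<in>E. card {(u, v). {u, v} = e}) \<le> of_nat (card E) * 2" by (intro sum_bounded_above) auto
  moreover have "arcs E = (\<Union>e\<in>E. {(u, v). {u, v} = e})" by (auto simp: arcs_def)
  then have "card (arcs E) \<le> (\<Sum>e\<in>E. card {(u, v). {u, v} = e})" using card_UN_le[OF assms(1)] by metis
  ultimately show ?thesis by simp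
qed

text \<open>Neighbours inside \<open>S\<close> count as well. The factor 3 comes from Posa's lemma,
  where the neighbours of the set of end vertices lie in that set, its successors and its
  predecessors on a path.\<close>

definition expands :: "nat \<Rightarrow> 'a set \<Rightarrow> 'a set set \<Rightarrow> bool" where
  "expands k V E \<longleftrightarrow> (\<forall>S. S \<subseteq> V \<longrightarrow> S \<noteq> {} \<longrightarrow> card S \<le> k \<longrightarrow> 3 * card S \<le> card (arcs E `` S))"

lemma expands_mono:
  assumes "finite V" "E' \<subseteq> vpairs V" "E \<subseteq> E'" "expands k V E"
  shows "expands k V E'"
proof -
  have "card (arcs E `` S) \<le> card (arcs E' `` S)" for S
    using arcs_mono[OF assms(3)] finite_arcs[OF assms(1,2)] by (intro card_mono finite_Image) auto
  note mono = this
  show ?thesis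
    unfolding expands_def
  proof (intro allI impI)
    fix S assume "S \<subseteq> V" "S \<noteq> {}" "card S \<le> k"
    then have "3 * card S \<le> card (arcs E `` S)" using assms(4) unfolding expands_def by simp
    then show "3 * card S \<le> card (arcs E' `` S)" using mono by (rule order_trans)
  qed
qed

text \<open>Connectivity in cut form, which directly yields an edge leaving the vertex set of a
  cycle.\<close>

definition linked :: "'a set \<Rightarrow> 'a set set \<Rightarrow> bool" where
  "linked V E \<longleftrightarrow> (\<forall>U. U \<subseteq> V \<longrightarrow> U \<noteq> {} \<longrightarrow> U \<noteq> V \<longrightarrow> (\<exists>u\<in>U. \<exists>v\<in>V - U. {u, v} \<in> E))"

text \<open>A nonempty set closed under taking neighbours cannot have at most \<open>k\<close>
  elements, so it contains a \<open>k\<close>-set and with it more than half of all vertices. Two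
  complementary closed sets cannot both do so.\<close>

lemma expanding_linked:
  assumes V: "finite V" and E: "E \<subseteq> vpairs V" and small: "expands k V E"
    and big: "\<And>S. S \<subseteq> V \<Longrightarrow> card S = k \<Longrightarrow> card V < 2 * card (arcs E `` S)"
  shows "linked V E"
  unfolding linked_def
proof (intro allI impI, rule ccontr)
  fix U assume U: "U \<subseteq> V" "U \<noteq> {}" "U \<noteq> V" and no: "\<not> (\<exists>u\<in>U. \<exists>v\<in>V - U. {u, v} \<in> E)"
  have half: "card V < 2 * card X" if X: "X \<subseteq> V" "X \<noteq> {}" "arcs E `` X \<subseteq> X" for X
  proof -
    have finX: "finite X" using X(1) V by (rule finite_subset)
    then have "card (arcs E `` X) \<le> card X" using X(3) by (rule card_mono)
    moreover have "0 < card X" using X(2) finX by auto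
    ultimately have "\<not> 3 * card X \<le> card (arcs E `` X)" by linarith
    then have "\<not> card X \<le> k" using small X(1,2) unfolding expands_def by blast
    then have "k \<le> card X" by simp
    then obtain S where S: "S \<subseteq> X" "card S = k" by (rule obtain_subset_with_card_n)
    have "card V < 2 * card (arcs E `` S)" using S X(1) by (intro big) auto
    moreover have "card (arcs E `` S) \<le> card X" using S X(3) finX by (intro card_mono) auto
    ultimately show ?thesis by simp
  qed
  have closed: "v \<in> U" if "(u, v) \<in> arcs E" "u \<in> U" for u v
    using that no arcs_subset[OF E] unfolding arcs_def by blast
  have "arcs E `` U \<subseteq> U" using closed by blast
  moreover have "arcs E `` (V - U) \<subseteq> V - U"
    using closed arcs_commute[of _ _ E] arcs_subset[OF E] by blast
  ultimately have "card V < 2 * card U" "card V < 2 * card (V - U)"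
    using U by (auto intro!: half)
  moreover have "card (V - U) = card V - card U" using U V by (intro card_Diff_subset) (auto intro: finite_subset)
  ultimately show False by linarith
qed

section \<open>Rotations and boosters\<close>

definition steps :: "'a list \<Rightarrow> ('a \<times> 'a) set" where
  "steps xs = set (zip xs (tl xs))"

lemma steps_simps[simp]: "steps [] = {}" "steps [x] = {}" "steps (x # y # xs) = insert (x, y) (steps (y # xs))"
  by (auto simp: steps_def)

lemma steps_append: "xs \<noteq> [] \<Longrightarrow> ys \<noteq> [] \<Longrightarrow> steps (xs @ ys) = insert (last xs, hd ys) (steps xs \<union> steps ys)"
proof (induction xs rule: induct_list012)
  case (2 x)
  then show ?case by (cases ys) auto
qed auto

lemma steps_rev: "steps (rev xs) = (steps xs)\<inverse>"
proof (induction xs rule: induct_list012)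
  case (3 x y zs)
  have "steps (rev (y # zs) @ [x]) = insert (y, x) (steps (rev (y # zs)))"
    using steps_append[of "rev (y # zs)" "[x]"] by (simp add: last_rev)
  then show ?case using 3 by auto
qed auto

lemma steps_in_set: "(u, v) \<in> steps xs \<Longrightarrow> u \<in> set xs \<and> v \<in> set xs"
  by (induction xs rule: induct_list012) auto

lemma steps_not_hd: "distinct xs \<Longrightarrow> (u, v) \<in> steps xs \<Longrightarrow> v \<noteq> hd xs"
  by (induction xs rule: induct_list012) (auto dest: steps_in_set)

lemma steps_not_last: "distinct xs \<Longrightarrow> (u, v) \<in> steps xs \<Longrightarrow> u \<noteq> last xs"
  by (induction xs rule: induct_list012) (auto dest: steps_in_set split: if_splits)

lemma steps_unique_succ: "distinct xs \<Longrightarrow> (u, v) \<in> steps xs \<Longrightarrow> (u, w) \<in> steps xs \<Longrightarrow> v = w"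
  by (induction xs rule: induct_list012) (auto dest: steps_in_set)

lemma steps_unique_pred: "distinct xs \<Longrightarrow> (v, u) \<in> steps xs \<Longrightarrow> (w, u) \<in> steps xs \<Longrightarrow> v = w"
  using steps_unique_succ[of "rev xs" u v w] by (simp add: steps_rev)

lemma steps_asym: "distinct xs \<Longrightarrow> (u, v) \<in> steps xs \<Longrightarrow> (v, u) \<notin> steps xs"
  by (induction xs rule: induct_list012) (auto dest: steps_in_set)

lemma steps_succ_ex: "u \<in> set xs \<Longrightarrow> u \<noteq> last xs \<Longrightarrow> \<exists>v. (u, v) \<in> steps xs"
  by (induction xs rule: induct_list012) (auto split: if_splits)

lemma steps_pred_ex: "u \<in> set xs \<Longrightarrow> u \<noteq> hd xs \<Longrightarrow> \<exists>v. (v, u) \<in> steps xs"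
  using steps_succ_ex[of u "rev xs"] by (simp add: steps_rev last_rev)

definition is_path :: "'a set \<Rightarrow> 'a set set \<Rightarrow> 'a list \<Rightarrow> bool" where
  "is_path V E xs \<longleftrightarrow> xs \<noteq> [] \<and> distinct xs \<and> set xs \<subseteq> V \<and> steps xs \<subseteq> arcs E"

definition longest_path :: "'a set \<Rightarrow> 'a set set \<Rightarrow> 'a list \<Rightarrow> bool" where
  "longest_path V E xs \<longleftrightarrow> is_path V E xs \<and> (\<forall>ys. is_path V E ys \<longrightarrow> length ys \<le> length xs)"

lemma converse_subset_arcs: "A \<subseteq> arcs E \<Longrightarrow> A\<inverse> \<subseteq> arcs E"
  by (auto simp: arcs_def insert_commute)

lemma is_path_rev: "is_path V E xs \<Longrightarrow> is_path V E (rev xs)"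
  by (simp add: is_path_def steps_rev converse_subset_arcs)

lemma longest_path_rev: "longest_path V E xs \<Longrightarrow> longest_path V E (rev xs)"
  by (simp add: longest_path_def is_path_rev)

lemma is_path_length: "finite V \<Longrightarrow> is_path V E xs \<Longrightarrow> length xs \<le> card V"
  unfolding is_path_def using card_mono[of V "set xs"] by (simp add: distinct_card)

lemma longest_path_ex:
  assumes "finite V" "is_path V E xs"
  shows "\<exists>ys. longest_path V E ys \<and> length xs \<le> length ys"
proof -
  have "\<exists>ys. is_path V E ys \<and> (\<forall>zs. is_path V E zs \<longrightarrow> length zs \<le> length ys)"
    by (rule ex_has_greatest_nat[of "is_path V E" xs length "card V + 1"])
       (use assms is_path_length[OF assms(1)] in \<open>auto simp: less_Suc_eq_le\<close>)
  then show ?thesis using assms unfolding longest_path_def by blast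
qed

text \<open>Posa rotations with fixed first vertex: the edge from the last vertex back to
  \<open>z\<close> replaces the step from \<open>z\<close> to \<open>hd bs\<close>, and
  \<open>hd bs\<close> becomes the new last vertex.\<close>

inductive_set rotations :: "'a set set \<Rightarrow> 'a list \<Rightarrow> 'a list set" for E xs where
  start: "xs \<in> rotations E xs"
| rotate: "as @ z # bs \<in> rotations E xs \<Longrightarrow> bs \<noteq> [] \<Longrightarrow> {z, last bs} \<in> E \<Longrightarrow> as @ z # rev bs \<in> rotations E xs"

lemma steps_pivot: "bs \<noteq> [] \<Longrightarrow> steps (as @ z # bs) = steps (as @ [z]) \<union> insert (z, hd bs) (steps bs)"
  using steps_append[of "as @ [z]" bs] by auto

lemma rotations_path:
  assumes "is_path V E xs" "ys \<in> rotations E xs"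
  shows "is_path V E ys \<and> set ys = set xs \<and> length ys = length xs \<and> hd ys = hd xs"
  using assms(2)
proof induction
  case (rotate as z bs)
  have "steps (as @ z # rev bs) \<subseteq> arcs E"
    using rotate by (auto simp: steps_pivot is_path_def steps_rev hd_rev arcs_def insert_commute)
  moreover have "hd (as @ z # rev bs) = hd (as @ z # bs)" by (cases as) auto
  ultimately show ?case using rotate by (auto simp: is_path_def)
qed (use assms in simp)

text \<open>The only step a rotation destroys is the one into \<open>hd bs\<close>, which thereby
  becomes an end vertex. A step between two vertices that are never end vertices thus survives, up
  to orientation.\<close>

lemma rotations_keep_steps:
  assumes "ys \<in> rotations E xs" "(u, v) \<in> steps xs"
    "u \<notin> last ` rotations E xs" "v \<notin> last ` rotations E xs"
  shows "(u, v) \<in> steps ys \<or> (v, u) \<in> steps ys"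
  using assms(1)
proof induction
  case (rotate as z bs)
  have "as @ z # rev bs \<in> rotations E xs" using rotate by (intro rotations.rotate)
  then have "hd bs \<in> last ` rotations E xs"
    using rotate.hyps(2) by (force simp: last_rev image_iff)
  then have "hd bs \<noteq> u" "hd bs \<noteq> v" using assms by auto
  then show ?case using rotate by (auto simp: steps_pivot steps_rev)
qed (use assms in simp)

text \<open>If neither \<open>w\<close> nor a neighbour of \<open>w\<close> on \<open>xs\<close> is
  ever an end vertex, then both steps of \<open>xs\<close> at \<open>w\<close> are still in
  \<open>ys\<close>. But the edge from \<open>y\<close> to \<open>w\<close> permits a rotation that
  turns the successor of \<open>w\<close> in \<open>ys\<close> into an end vertex, a
  contradiction.\<close>

lemma posa_neighbours:
  assumes E: "E \<subseteq> vpairs V" and xs: "longest_path V E xs"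
    and R: "R = last ` rotations E xs" and y: "y \<in> R" "(y, w) \<in> arcs E"
  shows "w \<in> R \<or> (\<exists>r\<in>R. (r, w) \<in> steps xs \<or> (w, r) \<in> steps xs)"
proof (rule ccontr)
  assume contra: "\<not> ?thesis"
  have path: "is_path V E xs" using xs by (simp add: longest_path_def)
  obtain ys where ys: "ys \<in> rotations E xs" "last ys = y" using R y by auto
  have ysP: "is_path V E ys" "set ys = set xs" "length ys = length xs" "hd ys = hd xs"
    using rotations_path[OF path ys(1)] by auto
  have dist: "distinct xs" "distinct ys" using path ysP by (auto simp: is_path_def)
  have "w \<in> set ys"
  proof (rule ccontr)
    assume w: "w \<notin> set ys"
    have "w \<in> V" using arcs_subset[OF E] y(2) by blast
    then have "is_path V E (ys @ [w])"
      using ysP(1) w ys(2) y(2) by (auto simp: is_path_def steps_append)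
    then have "length (ys @ [w]) \<le> length xs" using xs unfolding longest_path_def by blast
    then show False using ysP(3) by simp
  qed
  then obtain as bs where split: "ys = as @ w # bs" by (meson split_list)
  have "w \<noteq> last ys" using contra ys(2) y(1) by blast
  then have bs: "bs \<noteq> []" using split by auto
  have "{w, last bs} \<in> E" using y(2) ys(2) split bs by (simp add: arcs_def insert_commute)
  then have "as @ w # rev bs \<in> rotations E xs"
    using ys(1) split bs rotations.rotate by metis
  then have bR: "hd bs \<in> R"
    unfolding R using bs by (force simp: last_rev image_iff)
  have wb: "(w, hd bs) \<in> steps ys" using split bs by (simp add: steps_pivot)
  have kept: "(u, v) \<in> steps ys \<or> (v, u) \<in> steps ys" if "(u, v) \<in> steps xs" "u = w \<or> v = w" for u v
    using rotations_keep_steps[OF ys(1) that(1)] that contra R by blast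
  have "w \<noteq> last xs" using contra rotations.start[of xs E] R by blast
  then obtain c where c: "(w, c) \<in> steps xs"
    using steps_succ_ex \<open>w \<in> set ys\<close> ysP(2) by metis
  then have "c \<notin> R" using contra by blast
  \<comment> \<open>The successor of \<open>w\<close> in \<open>ys\<close> is \<open>hd bs\<close>,
    a member of \<open>R\<close>. As \<open>c\<close> is not in \<open>R\<close>, the surviving step
    runs from \<open>c\<close> to \<open>w\<close>; the same holds for the predecessor
    \<open>a\<close>, whence \<open>a = c\<close>.\<close>
  then have cw: "(c, w) \<in> steps ys"
    using kept[OF c] steps_unique_succ[OF dist(2) wb] bR by blast
  then have "w \<noteq> hd xs" using steps_not_hd[OF dist(2)] ysP(4) by metis
  then obtain a where a: "(a, w) \<in> steps xs"
    using steps_pred_ex \<open>w \<in> set ys\<close> ysP(2) by metis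
  then have "a \<notin> R" using contra by blast
  then have "(a, w) \<in> steps ys"
    using kept[OF a] steps_unique_succ[OF dist(2) wb] bR by blast
  then have "a = c" using steps_unique_pred[OF dist(2)] cw by metis
  then show False using a c steps_asym[OF dist(1)] by blast
qed

lemma card_Image_single_valued:
  assumes "finite A" "single_valued r"
  shows "card (r `` A) \<le> card A"
proof -
  have "r `` A \<subseteq> (\<lambda>a. THE b. (a, b) \<in> r) ` A"
  proof
    fix b assume "b \<in> r `` A"
    then obtain a where a: "a \<in> A" "(a, b) \<in> r" by blast
    then have "(THE b. (a, b) \<in> r) = b"
      using assms(2) by (intro the_equality) (auto dest: single_valuedD)
    then show "b \<in> (\<lambda>a. THE b. (a, b) \<in> r) ` A" using a by force
  qed
  then have "card (r `` A) \<le> card ((\<lambda>a. THE b. (a, b) \<in> r) ` A)" using assms(1) by (intro card_mono) auto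
  also have "\<dots> \<le> card A" using assms(1) by (rule card_image_le)
  finally show ?thesis .
qed

text \<open>The end vertices \<open>R\<close> have all their neighbours in \<open>R\<close>, its
  successors and its predecessors on \<open>xs\<close>. Since \<open>last xs\<close> has no
  successor, these are fewer than \<open>3 * card R\<close>, which expansion forbids for sets of
  size at most \<open>k\<close>.\<close>

lemma posa_endpoints:
  assumes V: "finite V" and E: "E \<subseteq> vpairs V" and exp: "expands k V E" and xs: "longest_path V E xs"
  shows "\<exists>R\<subseteq>set xs. k < card R \<and> (\<forall>y\<in>R. \<exists>ys. longest_path V E ys \<and> hd ys = hd xs \<and> last ys = y)"
proof -
  define R where "R = last ` rotations E xs"
  have path: "is_path V E xs" using xs by (simp add: longest_path_def)
  have dist: "distinct xs" and xsV: "set xs \<subseteq> V" and ne: "xs \<noteq> []" using path by (auto simp: is_path_def)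
  have sub: "R \<subseteq> set xs"
  proof
    fix y assume "y \<in> R"
    then obtain ys where "ys \<in> rotations E xs" "last ys = y" by (auto simp: R_def)
    then show "y \<in> set xs" using rotations_path[OF path] by (metis is_path_def last_in_set)
  qed
  have lastR: "last xs \<in> R" unfolding R_def by (intro imageI rotations.start)
  have finR: "finite R" using sub finite_subset by blast
  have "arcs E `` R \<subseteq> R \<union> (steps xs `` (R - {last xs}) \<union> (steps xs)\<inverse> `` R)"
    using posa_neighbours[OF E xs R_def] steps_not_last[OF dist] by blast
  then have "card (arcs E `` R) \<le> card (R \<union> (steps xs `` (R - {last xs}) \<union> (steps xs)\<inverse> `` R))"
    using finR by (intro card_mono) (auto simp: steps_def intro!: finite_Image)
  also have "\<dots> \<le> card R + (card (steps xs `` (R - {last xs})) + card ((steps xs)\<inverse> `` R))"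
    by (intro order_trans[OF card_Un_le] add_left_mono card_Un_le)
  also have "\<dots> \<le> card R + (card (R - {last xs}) + card R)"
    using finR steps_unique_succ[OF dist] steps_unique_pred[OF dist]
    by (intro add_left_mono add_mono card_Image_single_valued) (auto simp: single_valued_def)
  also have "\<dots> < 3 * card R"
    using card_Diff1_less[OF finR lastR] by linarith
  finally have "\<not> 3 * card R \<le> card (arcs E `` R)" by simp
  moreover have "R \<subseteq> V" "R \<noteq> {}" using sub xsV lastR by auto
  ultimately have "k < card R" using exp unfolding expands_def by (meson not_le)
  moreover have "\<exists>ys. longest_path V E ys \<and> hd ys = hd xs \<and> last ys = y" if "y \<in> R" for y
  proof -
    obtain ys where "ys \<in> rotations E xs" "last ys = y" using \<open>y \<in> R\<close> by (auto simp: R_def)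
    then show ?thesis using rotations_path[OF path] xs unfolding longest_path_def by metis
  qed
  ultimately show ?thesis using sub by blast
qed

definition boosters :: "'a set \<Rightarrow> 'a set set \<Rightarrow> 'a set set" where
  "boosters V E = {{hd ys, last ys} | ys. longest_path V E ys \<and> hd ys \<noteq> last ys}"

lemma boosters_subset: "boosters V E \<subseteq> vpairs V"
proof
  fix e assume "e \<in> boosters V E"
  then obtain ys where ys: "e = {hd ys, last ys}" "is_path V E ys" "hd ys \<noteq> last ys"
    by (auto simp: boosters_def longest_path_def)
  then have "hd ys \<in> V" "last ys \<in> V" using hd_in_set[of ys] last_in_set[of ys] by (auto simp: is_path_def)
  then show "e \<in> vpairs V" using ys by (simp add: in_vpairs_iff)
qed

text \<open>Rotations are used at both ends: more than \<open>k\<close> last vertices for a fixed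
  first one, and, after reversing each of these paths, at least \<open>k\<close> partners for every
  such vertex. Each pair is counted at most twice.\<close>

lemma card_boosters:
  assumes V: "finite V" "V \<noteq> {}" and E: "E \<subseteq> vpairs V" and exp: "expands k V E"
  shows "k * k \<le> 2 * card (boosters V E)"
proof -
  obtain v where "v \<in> V" using V by blast
  then have "is_path V E [v]" by (simp add: is_path_def)
  then obtain xs where xs: "longest_path V E xs" using longest_path_ex[OF V(1)] by blast
  obtain R where R: "R \<subseteq> set xs" "k < card R" "\<And>y. y \<in> R \<Longrightarrow> \<exists>ys. longest_path V E ys \<and> hd ys = hd xs \<and> last ys = y"
    using posa_endpoints[OF V(1) E exp xs] by blast
  have second: "\<exists>Q. finite Q \<and> k \<le> card Q \<and> (\<forall>z\<in>Q. (y, z) \<in> arcs (boosters V E))" if y: "y \<in> R" for y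
  proof -
    obtain ys where ys: "longest_path V E ys" "last ys = y" using R(3)[OF y] by blast
    then have rev: "longest_path V E (rev ys)" "hd (rev ys) = y"
      by (auto simp: longest_path_rev hd_rev)
    obtain Q where Q: "Q \<subseteq> set (rev ys)" "k < card Q" "\<And>z. z \<in> Q \<Longrightarrow> \<exists>zs. longest_path V E zs \<and> hd zs = y \<and> last zs = z"
      using posa_endpoints[OF V(1) E exp rev(1)] rev(2) by blast
    have finQ: "finite Q" using Q(1) finite_subset by blast
    have "k \<le> card (Q - {y})" using Q(2) finQ by (auto simp: card_Diff_singleton_if)
    moreover have "(y, z) \<in> arcs (boosters V E)" if "z \<in> Q - {y}" for z
      using Q(3)[of z] that by (force simp: arcs_def boosters_def)
    ultimately show ?thesis using finQ by (intro exI[of _ "Q - {y}"]) auto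
  qed
  then obtain Q where Q: "\<And>y. y \<in> R \<Longrightarrow> finite (Q y) \<and> k \<le> card (Q y) \<and> (\<forall>z\<in>Q y. (y, z) \<in> arcs (boosters V E))"
    by metis
  have finR: "finite R" using R(1) finite_subset by blast
  have finB: "finite (boosters V E)" using finite_subset[OF boosters_subset finite_vpairs[OF V(1)]] .
  have "k * k \<le> card R * k" using R(2) by simp
  also have "\<dots> \<le> (\<Sum>y\<in>R. card (Q y))" using Q sum_bounded_below[of R k "\<lambda>y. card (Q y)"] by simp
  also have "\<dots> = card (Sigma R Q)" using finR Q by (intro card_SigmaI[symmetric]) auto
  also have "\<dots> \<le> card (arcs (boosters V E))"
    using Q finite_arcs[OF V(1) boosters_subset] by (intro card_mono) auto
  also have "\<dots> \<le> 2 * card (boosters V E)" by (rule card_arcs_le[OF finB boosters_subset])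
  finally show ?thesis .
qed

lemma is_cycle_of_path:
  assumes "is_path V E xs" "3 \<le> length xs" "{hd xs, last xs} \<in> E"
  shows "is_cycle E xs"
  unfolding is_cycle_def
proof (intro conjI allI impI)
  fix i assume i: "i < length xs"
  show "{xs ! i, xs ! (Suc i mod length xs)} \<in> E"
  proof (cases "Suc i = length xs")
    case True
    then have "xs ! i = last xs" using assms(2) by (metis diff_Suc_1 last_conv_nth list.size(3) not_numeral_le_zero)
    moreover have "xs ! 0 = hd xs" using assms(2) by (intro hd_conv_nth[symmetric]) auto
    ultimately show ?thesis using True assms(3) by (simp add: insert_commute)
  next
    case False
    then have "Suc i < length xs" using i by simp
    then have "(xs ! i, xs ! Suc i) \<in> steps xs"
      by (auto simp: steps_def set_zip nth_tl intro!: exI[of _ i])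
    then show ?thesis using assms(1) \<open>Suc i < length xs\<close> by (auto simp: is_path_def arcs_def)
  qed
qed (use assms in \<open>auto simp: is_path_def\<close>)

text \<open>The closed path is a cycle. If it is not spanning, connectivity gives an edge from some
  \<open>u\<close> on it to a vertex outside, and opening the cycle at \<open>u\<close> prepends
  that vertex.\<close>

lemma booster_extends:
  assumes xs: "is_path V E xs" "3 \<le> length xs" and E': "E \<subseteq> E'" "{hd xs, last xs} \<in> E'"
    and linked: "linked V E"
  shows "hamiltonian V E' \<or> (\<exists>zs. is_path V E' zs \<and> length zs = Suc (length xs))"
proof (cases "set xs = V")
  case True
  have "is_path V E' xs" using xs E' arcs_mono[OF E'(1)] by (auto simp: is_path_def)
  then have "is_cycle E' xs" using xs E' by (intro is_cycle_of_path)
  then show ?thesis using True unfolding hamiltonian_def by blast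
next
  case False
  have path': "distinct xs" "set xs \<subseteq> V" "steps xs \<subseteq> arcs E'" using xs arcs_mono[OF E'(1)] by (auto simp: is_path_def)
  have "set xs \<noteq> {}" using xs by (auto simp: is_path_def)
  then obtain u v where uv: "u \<in> set xs" "v \<in> V - set xs" "{u, v} \<in> E"
    using linked False path'(2) unfolding linked_def by blast
  then obtain as bs where split: "xs = as @ u # bs" by (meson split_list)
  have vu: "(v, u) \<in> arcs E'" using uv E' by (auto simp: arcs_def insert_commute)
  have "steps ((u # bs) @ as) \<subseteq> arcs E'"
  proof (cases "as = []")
    case True
    then show ?thesis using path' split by simp
  next
    case False
    have "steps xs = insert (last as, u) (steps as \<union> steps (u # bs))"
      using False by (simp add: split steps_append)
    moreover have "steps ((u # bs) @ as) = insert (last (u # bs), hd as) (steps (u # bs) \<union> steps as)"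
      using False by (intro steps_append) auto
    moreover have "(last (u # bs), hd as) \<in> arcs E'"
      using E'(2) False split by (auto simp: arcs_def insert_commute)
    ultimately show ?thesis using path'(3) by simp
  qed
  then have "is_path V E' (v # (u # bs) @ as)"
    using path'(1,2) uv(1,2) vu unfolding split is_path_def by (simp add: Int_commute)
  then show ?thesis using split by (intro disjI2 exI[of _ "v # (u # bs) @ as"]) auto
qed

lemma hamiltonian_mono: "E \<subseteq> E' \<Longrightarrow> hamiltonian V E \<Longrightarrow> hamiltonian V E'"
  unfolding hamiltonian_def is_cycle_def by auto

lemma linked_mono: "E \<subseteq> E' \<Longrightarrow> linked V E \<Longrightarrow> linked V E'"
  unfolding linked_def by blast

text \<open>As long as no Hamilton cycle appears, each booster from \<open>G\<close> lengthens a
  longest path, so after \<open>card V\<close> additions a path would have more than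
  \<open>card V\<close> vertices. The graphs on the way have at most \<open>J\<close> edges, so
  \<open>boost\<close> applies to all of them.\<close>

lemma hamiltonian_by_boosters:
  assumes V: "finite V" "V \<noteq> {}" and G: "G \<subseteq> vpairs V" and k: "2 \<le> k"
    and \<Gamma>: "\<Gamma> \<subseteq> G" "expands k V \<Gamma>" "linked V \<Gamma>" "card \<Gamma> + card V \<le> J"
    and boost: "\<And>E. E \<subseteq> vpairs V \<Longrightarrow> card E \<le> J \<Longrightarrow> k * k \<le> 2 * card (boosters V E) \<Longrightarrow> G \<inter> boosters V E \<noteq> {}"
  shows "hamiltonian V G"
proof (rule ccontr)
  assume not_ham: "\<not> hamiltonian V G"
  have finG: "finite G" using finite_subset[OF G finite_vpairs[OF V(1)]] .
  have "\<exists>E. \<Gamma> \<subseteq> E \<and> E \<subseteq> G \<and> card E \<le> card \<Gamma> + j \<and> (\<exists>xs. is_path V E xs \<and> j < length xs)" if "j \<le> card V" for j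
    using that
  proof (induction j)
    case 0
    obtain v where "v \<in> V" using V by blast
    then have "is_path V \<Gamma> [v]" by (simp add: is_path_def)
    then show ?case using \<Gamma>(1) by (intro exI[of _ \<Gamma>]) auto
  next
    case (Suc j)
    then obtain E xs0 where E: "\<Gamma> \<subseteq> E" "E \<subseteq> G" "card E \<le> card \<Gamma> + j" and xs0: "is_path V E xs0" "j < length xs0" by auto
    have EV: "E \<subseteq> vpairs V" using E G by blast
    have exp: "expands k V E" by (rule expands_mono[OF V(1) EV E(1) \<Gamma>(2)])
    have "card E \<le> J" using E(3) Suc.prems \<Gamma>(4) by simp
    then have "G \<inter> boosters V E \<noteq> {}" using boost[OF EV] card_boosters[OF V EV exp] by blast
    then obtain ys where ys: "longest_path V E ys" "{hd ys, last ys} \<in> G" by (auto simp: boosters_def)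
    have path: "is_path V E ys" using ys by (simp add: longest_path_def)
    have jlen: "j < length ys" using xs0 ys(1) unfolding longest_path_def by (meson less_le_trans)
    obtain R where R: "R \<subseteq> set ys" "k < card R" using posa_endpoints[OF V(1) EV exp ys(1)] by blast
    \<comment> \<open>With \<open>2 \<le> k\<close> the path has at least three vertices, as closing
      it to a cycle requires.\<close>
    have "card R \<le> card (set ys)" using R by (intro card_mono) auto
    then have "3 \<le> length ys" using R(2) k card_length[of ys] by linarith
    then have ext: "hamiltonian V (insert {hd ys, last ys} E) \<or> (\<exists>zs. is_path V (insert {hd ys, last ys} E) zs \<and> length zs = Suc (length ys))"
      using path linked_mono[OF E(1) \<Gamma>(3)] by (intro booster_extends) auto
    have sub: "insert {hd ys, last ys} E \<subseteq> G" using ys E by blast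
    then have "\<not> hamiltonian V (insert {hd ys, last ys} E)" using not_ham hamiltonian_mono by blast
    then obtain zs where zs: "is_path V (insert {hd ys, last ys} E) zs" "length zs = Suc (length ys)" using ext by blast
    have "card (insert {hd ys, last ys} E) \<le> card \<Gamma> + Suc j"
      using E(3) finite_subset[OF E(2) finG] by (simp add: card_insert_if)
    then show ?case using sub E(1) zs jlen by (intro exI[of _ "insert {hd ys, last ys} E"]) auto
  qed
  then obtain E xs where E: "E \<subseteq> G" "is_path V E xs" "card V < length xs" by blast
  then show False using is_path_length[OF V(1), of E xs] by simp
qed

section \<open>Sparse hitting sets\<close>

definition cover_count :: "'a \<Rightarrow> 'a set list \<Rightarrow> nat" where
  "cover_count e Zs = length (filter (\<lambda>Z. e \<in> Z) Zs)"

text \<open>Pairs that lie in at least a hundredth of the sampled sets, \<open>m\<close> being the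
  length of the sample \<open>Zs\<close>. Samples are lists because repetitions count.\<close>

definition heavy :: "'a set \<Rightarrow> nat \<Rightarrow> 'a set set list \<Rightarrow> 'a set set" where
  "heavy V m Zs = {e \<in> vpairs V. m \<le> 100 * cover_count e Zs}"

text \<open>The value is forced by \<open>heavy_base ^ (m / 100) = 4 ^ m\<close>.\<close>

definition heavy_base :: nat where
  "heavy_base = 4 ^ 100"

lemma heavy_base_pos: "1 \<le> heavy_base"
  by (simp add: heavy_base_def)

text \<open>The list is built by derandomised sampling from \<open>Y\<close>: every new set is chosen so that the
  exponential potential at most doubles.\<close>

lemma list_with_small_cover_counts:
  fixes l :: real
  assumes Y: "finite Y" "Y \<noteq> {}" and l: "1 \<le> l"
    and rare: "\<And>e. e \<in> G \<Longrightarrow> l * card {Z \<in> Y. e \<in> Z} \<le> card Y"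
  shows "\<exists>Zs. length Zs = m \<and> set Zs \<subseteq> Y \<and> (\<Sum>e\<in>G. l ^ cover_count e Zs) \<le> card G * 2 ^ m"
proof (induction m)
  case 0
  show ?case by (simp add: cover_count_def)
next
  case (Suc m)
  then obtain Zs where Zs: "length Zs = m" "set Zs \<subseteq> Y" "(\<Sum>e\<in>G. l ^ cover_count e Zs) \<le> card G * 2 ^ m" by blast
  define \<Phi> where "\<Phi> = (\<Sum>e\<in>G. l ^ cover_count e Zs)"
  have "(\<Sum>Z\<in>Y. \<Sum>e\<in>G. l ^ cover_count e (Z # Zs)) = (\<Sum>e\<in>G. \<Sum>Z\<in>Y. l ^ cover_count e (Z # Zs))"
    by (rule sum.swap)
  also have "\<dots> \<le> (\<Sum>e\<in>G. l ^ cover_count e Zs * (2 * card Y))"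
  proof (rule sum_mono)
    fix e assume e: "e \<in> G"
    \<comment> \<open>One more set multiplies the weight of \<open>e\<close> by \<open>l\<close> or
      1, hence by at most \<open>l * of_bool (e \<in> Z) + 1\<close>; by rarity of \<open>e\<close>
      the mean of this factor over \<open>Y\<close> is at most 2.\<close>
    have "(\<Sum>Z\<in>Y. l ^ cover_count e (Z # Zs)) \<le> (\<Sum>Z\<in>Y. l ^ cover_count e Zs * (l * of_bool (e \<in> Z) + 1))"
      using l by (intro sum_mono) (auto simp: cover_count_def algebra_simps)
    also have "\<dots> = l ^ cover_count e Zs * (\<Sum>Z\<in>Y. l * of_bool (e \<in> Z) + 1)"
      by (simp add: sum_distrib_left)
    also have "(\<Sum>Z\<in>Y. l * of_bool (e \<in> Z) + 1) = l * card {Z \<in> Y. e \<in> Z} + card Y"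
      using Y(1) by (simp add: sum.distrib sum_distrib_left[symmetric] sum_of_bool_eq Int_def)
    also have "l ^ cover_count e Zs * (l * card {Z \<in> Y. e \<in> Z} + card Y) \<le> l ^ cover_count e Zs * (2 * card Y)"
      using rare[OF e] l by (intro mult_left_mono) auto
    finally show "(\<Sum>Z\<in>Y. l ^ cover_count e (Z # Zs)) \<le> l ^ cover_count e Zs * (2 * card Y)" .
  qed
  also have "\<dots> = (\<Sum>Z\<in>Y. 2 * \<Phi>)"
    by (simp add: \<Phi>_def sum_distrib_right[symmetric])
  finally have "\<exists>Z\<in>Y. (\<Sum>e\<in>G. l ^ cover_count e (Z # Zs)) \<le> 2 * \<Phi>"
    using sum_strict_mono[OF Y, of "\<lambda>_. 2 * \<Phi>" "\<lambda>Z. \<Sum>e\<in>G. l ^ cover_count e (Z # Zs)"] by (meson not_le)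
  then obtain Z where Z: "Z \<in> Y" "(\<Sum>e\<in>G. l ^ cover_count e (Z # Zs)) \<le> 2 * \<Phi>" by blast
  have "2 * \<Phi> \<le> card G * 2 ^ Suc m" using Zs(3) by (simp add: \<Phi>_def)
  then have "(\<Sum>e\<in>G. l ^ cover_count e (Z # Zs)) \<le> card G * 2 ^ Suc m" using Z(2) by linarith
  then show ?case using Zs Z by (intro exI[of _ "Z # Zs"]) auto
qed

text \<open>Without a frequent edge there is a sample of potential at most
  \<open>card G * 2 ^ m\<close>, less than \<open>4 ^ m\<close>. Yet \<open>G\<close> contains a
  heavy edge of this sample, whose weight alone is at least \<open>4 ^ m\<close>.\<close>

lemma frequent_edge:
  assumes G: "finite G" "G \<subseteq> vpairs V" "card G < 2 ^ m" and Y: "finite Y" "Y \<noteq> {}"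
    and heavy: "\<And>Zs. length Zs = m \<Longrightarrow> set Zs \<subseteq> Y \<Longrightarrow> G \<inter> heavy V m Zs \<noteq> {}"
  shows "\<exists>e\<in>G. card Y < real heavy_base * card {Z \<in> Y. e \<in> Z}"
proof (rule ccontr)
  assume "\<not> ?thesis"
  then have "\<And>e. e \<in> G \<Longrightarrow> real heavy_base * card {Z \<in> Y. e \<in> Z} \<le> card Y" by (simp add: not_less)
  moreover have l: "1 \<le> real heavy_base" using heavy_base_pos by simp
  ultimately obtain Zs where Zs: "length Zs = m" "set Zs \<subseteq> Y"
    and sum: "(\<Sum>e\<in>G. real heavy_base ^ cover_count e Zs) \<le> card G * 2 ^ m"
    using list_with_small_cover_counts[OF Y, of "real heavy_base" G m] by blast
  obtain e where e: "e \<in> G" "m \<le> 100 * cover_count e Zs" using heavy[OF Zs] by (auto simp: heavy_def)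
  have "(4::real) ^ m \<le> 4 ^ (100 * cover_count e Zs)" using e(2) by (intro power_increasing) auto
  also have "\<dots> = real heavy_base ^ cover_count e Zs"
    by (simp only: heavy_base_def power_mult of_nat_power of_nat_numeral)
  also have "\<dots> \<le> (\<Sum>e\<in>G. real heavy_base ^ cover_count e Zs)"
    using G(1) e(1) l by (intro member_le_sum) auto
  also have "\<dots> \<le> card G * 2 ^ m" by (rule sum)
  also have "\<dots> < real (2 ^ m * 2 ^ m)"
    unfolding of_nat_less_iff using G(3) by (intro mult_strict_right_mono) auto
  also have "\<dots> = 4 ^ m" by (simp flip: power_mult_distrib)
  finally show False by simp
qed

text \<open>Every new edge meets more than a fraction 1 / l of the sets that are still
  unmet.\<close>

lemma greedy_hitting_set:
  fixes l :: real
  assumes Z: "finite Z" and l: "1 \<le> l"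
    and frequent: "\<And>Y. Y \<subseteq> Z \<Longrightarrow> Y \<noteq> {} \<Longrightarrow> \<exists>e\<in>G. card Y < l * card {z \<in> Y. e \<in> z}"
  shows "\<exists>R\<subseteq>G. finite R \<and> card R \<le> t \<and> card {z \<in> Z. R \<inter> z = {}} \<le> (1 - 1 / l) ^ t * card Z"
proof (induction t)
  case 0
  show ?case by (intro exI[of _ "{}"]) auto
next
  case (Suc t)
  then obtain R where R: "R \<subseteq> G" "finite R" "card R \<le> t" "card {z \<in> Z. R \<inter> z = {}} \<le> (1 - 1 / l) ^ t * card Z" by blast
  define Y where "Y = {z \<in> Z. R \<inter> z = {}}"
  have l': "0 \<le> 1 - 1 / l" using l by simp
  show ?case
  proof (cases "Y = {}")
    case True
    then have "real (card {z \<in> Z. R \<inter> z = {}}) = 0" by (simp only: Y_def[symmetric] card.empty of_nat_0)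
    then show ?thesis using R l' by (intro exI[of _ R]) auto
  next
    case False
    have Y: "Y \<subseteq> Z" by (auto simp: Y_def)
    then have finY: "finite Y" using Z finite_subset by blast
    obtain e where e: "e \<in> G" "card Y < l * card {z \<in> Y. e \<in> z}" using frequent[OF Y False] by blast
    have "{z \<in> Z. insert e R \<inter> z = {}} = Y - {z \<in> Y. e \<in> z}" by (auto simp: Y_def)
    moreover have "card (Y - {z \<in> Y. e \<in> z}) = card Y - card {z \<in> Y. e \<in> z}"
      using finY by (intro card_Diff_subset) auto
    moreover have "card {z \<in> Y. e \<in> z} \<le> card Y" using finY by (intro card_mono) auto
    ultimately have "real (card {z \<in> Z. insert e R \<inter> z = {}}) = real (card Y) - real (card {z \<in> Y. e \<in> z})"
      by (simp add: of_nat_diff)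
    also have "\<dots> \<le> (1 - 1 / l) * card Y" using e(2) l by (simp add: field_simps)
    also have "\<dots> \<le> (1 - 1 / l) * ((1 - 1 / l) ^ t * card Z)"
      using R(4) l' by (intro mult_left_mono) (auto simp: Y_def)
    finally have "real (card {z \<in> Z. insert e R \<inter> z = {}}) \<le> (1 - 1 / l) ^ Suc t * card Z" by simp
    moreover have "card (insert e R) \<le> Suc t" using R(2,3) by (simp add: card_insert_if)
    ultimately show ?thesis using R e by (intro exI[of _ "insert e R"]) auto
  qed
qed

lemma sparse_hitting_set:
  assumes n: "1 \<le> n" and Z: "finite Z" "card Z \<le> 4 ^ n"
    and G: "finite G" "G \<subseteq> vpairs V" "card G < 2 ^ m"
    and heavy: "\<And>Zs. length Zs = m \<Longrightarrow> set Zs \<subseteq> Z \<Longrightarrow> G \<inter> heavy V m Zs \<noteq> {}"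
  shows "\<exists>R\<subseteq>G. card R \<le> 2 * heavy_base * n \<and> (\<forall>z\<in>Z. R \<inter> z \<noteq> {})"
proof -
  define l where "l = real heavy_base"
  have l: "1 \<le> l" using heavy_base_pos by (simp add: l_def)
  \<comment> \<open>After \<open>t\<close> greedy steps at most exp (-2 n) 4^n sets remain unmet.
    This is below 1 because e^2 > 4, and a number of sets below 1 is 0.\<close>
  define t where "t = 2 * heavy_base * n"
  have "\<exists>e\<in>G. card Y < l * card {z \<in> Y. e \<in> z}" if Y: "Y \<subseteq> Z" "Y \<noteq> {}" for Y
    unfolding l_def using Y finite_subset[OF Y(1) Z(1)] heavy by (intro frequent_edge[OF G]) auto
  then obtain R where R: "R \<subseteq> G" "card R \<le> t" "card {z \<in> Z. R \<inter> z = {}} \<le> (1 - 1 / l) ^ t * card Z"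
    using greedy_hitting_set[OF Z(1) l, of G t] by blast
  have "(1 - 1 / l) ^ t \<le> exp (- 1 / l) ^ t"
    using l exp_ge_add_one_self[of "- 1 / l"] by (intro power_mono) auto
  also have "\<dots> = exp (- (2 * real n))" using l by (simp add: t_def l_def flip: exp_of_nat_mult)
  finally have "(1 - 1 / l) ^ t * card Z \<le> exp (- (2 * real n)) * 4 ^ n"
    using Z(2) by (intro mult_mono) (auto simp flip: of_nat_le_iff)
  also have "\<dots> = (exp (- 2) * 4) ^ n" by (simp add: power_mult_distrib mult.commute flip: exp_of_nat_mult)
  also have "\<dots> < 1"
  proof -
    have "1 + 2 + 2\<^sup>2 / 2 \<le> exp (2::real)" by (rule exp_lower_Taylor_quadratic) simp
    then have "exp (- 2) * 4 < (1::real)" by (simp add: exp_minus field_simps)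
    moreover from this have "(exp (- 2) * 4) ^ n \<le> (exp (- 2) * 4 :: real) ^ 1"
      using n by (intro power_decreasing) auto
    ultimately show ?thesis by simp
  qed
  finally have "card {z \<in> Z. R \<inter> z = {}} = 0" using R(3) by linarith
  then have "\<forall>z\<in>Z. R \<inter> z \<noteq> {}" using Z(1) by auto
  then show ?thesis using R by (auto simp: t_def)
qed

section \<open>Heavy pairs and pairs between two large vertex sets\<close>

lemma sum_cover_count:
  assumes "finite P" "\<And>Z. Z \<in> set Zs \<Longrightarrow> Z \<subseteq> P"
  shows "(\<Sum>e\<in>P. cover_count e Zs) = sum_list (map card Zs)"
  using assms(2)
proof (induction Zs)
  case (Cons Z Zs)
  have "(\<Sum>e\<in>P. cover_count e (Z # Zs)) = (\<Sum>e\<in>P. of_bool (e \<in> Z) + cover_count e Zs)"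
    by (intro sum.cong) (auto simp: cover_count_def)
  also have "\<dots> = card (P \<inter> Z) + (\<Sum>e\<in>P. cover_count e Zs)"
    using assms(1) by (simp add: sum.distrib sum_of_bool_eq Int_def)
  also have "P \<inter> Z = Z" using Cons.prems by auto
  finally show ?case using Cons by simp
qed (simp add: cover_count_def)

text \<open>Double counting of incidences between pairs and sampled sets: a heavy pair lies in at
  most m of the sets, any other pair in at most m / 100.\<close>

lemma card_heavy:
  assumes V: "finite V" and m: "length Zs = m" "0 < m"
    and Zs: "\<And>Z. Z \<in> set Zs \<Longrightarrow> Z \<subseteq> vpairs V \<and> c \<le> card Z"
  shows "100 * c \<le> 100 * card (heavy V m Zs) + card (vpairs V)"
proof -
  have finP: "finite (vpairs V)" by (rule finite_vpairs[OF V])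
  have bound: "100 * cover_count e Zs \<le> 100 * m * of_bool (e \<in> heavy V m Zs) + m" if "e \<in> vpairs V" for e
  proof (cases "e \<in> heavy V m Zs")
    case True
    have "cover_count e Zs \<le> m" using m by (simp add: cover_count_def length_filter_le[THEN order_trans])
    then show ?thesis using True by simp
  next
    case False
    then show ?thesis using that by (simp add: heavy_def)
  qed
  have "m * c = sum_list (map (\<lambda>_. c) Zs)" by (simp add: m(1)[symmetric] sum_list_triv)
  also have "\<dots> \<le> sum_list (map card Zs)" using Zs by (intro sum_list_mono) auto
  also have "\<dots> = (\<Sum>e\<in>vpairs V. cover_count e Zs)"
    using Zs by (intro sum_cover_count[symmetric] finP) auto
  finally have "m * (100 * c) \<le> (\<Sum>e\<in>vpairs V. 100 * cover_count e Zs)" by (simp add: sum_distrib_left[symmetric])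
  also have "\<dots> \<le> (\<Sum>e\<in>vpairs V. 100 * m * of_bool (e \<in> heavy V m Zs) + m)"
    by (intro sum_mono bound)
  also have "\<dots> = 100 * m * card (vpairs V \<inter> heavy V m Zs) + m * card (vpairs V)"
    using finP by (simp add: sum.distrib sum_distrib_left[symmetric] sum_of_bool_eq Int_def)
  also have "vpairs V \<inter> heavy V m Zs = heavy V m Zs" by (auto simp: heavy_def)
  finally have "m * (100 * c) \<le> m * (100 * card (heavy V m Zs) + card (vpairs V))" by (simp add: algebra_simps)
  then show ?thesis using m(2) by simp
qed

definition cross :: "'a set \<Rightarrow> 'a set \<Rightarrow> 'a set set" where
  "cross A B = {{a, b} | a b. a \<in> A \<and> b \<in> B \<and> a \<noteq> b}"

lemma cross_subset: "A \<subseteq> V \<Longrightarrow> B \<subseteq> V \<Longrightarrow> cross A B \<subseteq> vpairs V"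
  by (auto simp: cross_def vpairs_def)

text \<open>\<open>A\<close> and \<open>B\<close> may overlap: a pair can then come from two ordered
  ones, and up to \<open>card A\<close> ordered pairs are degenerate.\<close>

lemma card_cross:
  assumes V: "finite V" and AB: "A \<subseteq> V" "B \<subseteq> V"
  shows "card A * card B \<le> 2 * card (cross A B) + card A"
proof -
  have fin: "finite A" "finite B" using AB V finite_subset by auto
  have "card A * card B = card (A \<times> B)" by (simp add: card_cartesian_product)
  also have "\<dots> \<le> card (arcs (cross A B) \<union> (\<lambda>a. (a, a)) ` A)"
    using fin finite_arcs[OF V cross_subset[OF AB]] by (intro card_mono) (auto simp: arcs_def cross_def)
  also have "\<dots> \<le> card (arcs (cross A B)) + card ((\<lambda>a. (a, a)) ` A)" by (rule card_Un_le)
  also have "\<dots> \<le> 2 * card (cross A B) + card A"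
    using fin finite_subset[OF cross_subset[OF AB] finite_vpairs[OF V]]
    by (intro add_mono card_arcs_le[OF _ cross_subset[OF AB]] card_image_le) auto
  finally show ?thesis .
qed

text \<open>The sizes are such that a graph meeting all these sets gives every \<open>k\<close>-set
  of vertices more than half of all vertices as neighbours: otherwise the non-neighbours would
  contain a suitable \<open>B\<close>.\<close>

definition crosses :: "nat \<Rightarrow> 'a set \<Rightarrow> 'a set set set" where
  "crosses k V = {cross A B | A B. A \<subseteq> V \<and> B \<subseteq> V \<and> card A = k \<and> card B = card V div 2}"

lemma crosses_image: "crosses k V \<subseteq> (\<lambda>(A, B). cross A B) ` (Pow V \<times> Pow V)"
  by (auto simp: crosses_def)

lemma finite_crosses: "finite V \<Longrightarrow> finite (crosses k V)"
  by (rule finite_subset[OF crosses_image]) auto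

lemma card_crosses:
  assumes "finite V"
  shows "card (crosses k V) \<le> 4 ^ card V"
proof -
  have "card (crosses k V) \<le> card ((\<lambda>(A, B). cross A B) ` (Pow V \<times> Pow V))"
    using assms by (intro card_mono crosses_image) auto
  also have "\<dots> \<le> card (Pow V \<times> Pow V)" using assms by (intro card_image_le) auto
  also have "\<dots> = 4 ^ card V" using assms by (simp add: card_cartesian_product card_Pow flip: power_mult_distrib)
  finally show ?thesis .
qed

lemma hitting_crosses_expands:
  assumes V: "finite V" and R: "R \<subseteq> vpairs V" and hit: "\<And>z. z \<in> crosses k V \<Longrightarrow> R \<inter> z \<noteq> {}"
    and S: "S \<subseteq> V" "card S = k"
  shows "card V < 2 * card (arcs R `` S)"
proof (rule ccontr)
  assume "\<not> ?thesis"
  then have le: "2 * card (arcs R `` S) \<le> card V" by simp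
  have "arcs R `` S \<subseteq> V" using arcs_subset[OF R] by blast
  then have "card (V - arcs R `` S) = card V - card (arcs R `` S)"
    using V by (intro card_Diff_subset) (auto intro: finite_subset)
  then have "card V div 2 \<le> card (V - arcs R `` S)" using le by linarith
  then obtain B where B: "B \<subseteq> V - arcs R `` S" "card B = card V div 2" by (rule obtain_subset_with_card_n)
  then have "cross S B \<in> crosses k V" using S by (auto simp: crosses_def)
  then obtain e where "e \<in> R" "e \<in> cross S B" using hit by blast
  then obtain a b where "a \<in> S" "b \<in> B" "{a, b} \<in> R" by (auto simp: cross_def)
  then show False using B by (auto simp: arcs_def)
qed

text \<open>The deterministic part. Each requirement on \<open>G\<close> amounts to meeting all
  members of a family of large sets of pairs; this is the form that a union bound can
  deliver.\<close>

theorem hamiltonian_criterion: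
  assumes V: "finite V" "card V = n" and k: "2 \<le> k" "12 * k \<le> n" and G: "G \<subseteq> vpairs V"
    and small: "expands k V G" and m: "card (vpairs V) < 2 ^ m"
    and heavy: "\<And>Zs. length Zs = m \<Longrightarrow> set Zs \<subseteq> crosses k V \<Longrightarrow> G \<inter> heavy V m Zs \<noteq> {}"
    and J: "(4 * heavy_base + 4) * n \<le> J"
    and boost: "\<And>E. E \<subseteq> vpairs V \<Longrightarrow> card E \<le> J \<Longrightarrow> k * k \<le> 2 * card (boosters V E) \<Longrightarrow> G \<inter> boosters V E \<noteq> {}"
  shows "hamiltonian V G"
proof -
  have finG: "finite G" using finite_subset[OF G finite_vpairs[OF V(1)]] .
  have "card G \<le> card (vpairs V)" using G finite_vpairs[OF V(1)] by (intro card_mono)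
  then have cardG: "card G < 2 ^ m" using m by linarith
  obtain R where R: "R \<subseteq> G" "card R \<le> 2 * heavy_base * n" "\<And>z. z \<in> crosses k V \<Longrightarrow> R \<inter> z \<noteq> {}"
    using sparse_hitting_set[OF _ finite_crosses[OF V(1)] _ finG G cardG heavy, of n k] card_crosses[OF V(1), of k] V(2) k by auto
  have RV: "R \<subseteq> vpairs V" using R(1) G by blast
  have finR: "finite R" using R(1) finG finite_subset by blast
  have half: "n < 2 * card (arcs R `` S)" if "S \<subseteq> V" "card S = k" for S
    using hitting_crosses_expands[OF V(1) RV R(3) that] V(2) by simp
  \<comment> \<open>Sets of up to \<open>2 * k\<close> vertices need \<open>6 * k\<close>
    neighbours, and more than n / 2 are available; this is where \<open>12 * k \<le> n\<close> comes
    from.\<close>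
  have big: "3 * card S \<le> card (arcs R `` S)" if S: "S \<subseteq> V" "k < card S" "card S \<le> 2 * k" for S
  proof -
    obtain T where T: "T \<subseteq> S" "card T = k" using obtain_subset_with_card_n[of k S] S(2) by auto
    have "card (arcs R `` T) \<le> card (arcs R `` S)"
      using T finite_arcs[OF V(1) RV] by (intro card_mono finite_Image) auto
    moreover have "n < 2 * card (arcs R `` T)" using T S by (intro half) auto
    ultimately show ?thesis using S(3) k(2) by linarith
  qed
  have smallG: "3 * card S \<le> card (arcs G `` S)" if "S \<subseteq> V" "S \<noteq> {}" "card S \<le> k" for S
    using small that unfolding expands_def by blast
  have "arcs G \<subseteq> V \<times> UNIV" using arcs_subset[OF G] by auto
  have "\<exists>W'. arcs R \<subseteq> W' \<and> W' \<subseteq> arcs G \<and> card W' \<le> card (arcs R) + 3 * card V \<and>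
     (\<forall>S. S \<subseteq> V \<longrightarrow> S \<noteq> {} \<longrightarrow> card S \<le> k \<longrightarrow> 3 * card S \<le> card (W' `` S))"
  proof (rule sparse_expanding_subrelation[OF finite_arcs[OF V(1) G] V(1) \<open>arcs G \<subseteq> V \<times> UNIV\<close> arcs_mono[OF R(1)]])
    show "3 * card S \<le> card (arcs G `` S)" if "S \<subseteq> V" "S \<noteq> {}" "card S \<le> k" for S
      by (rule smallG[OF that])
    show "3 * card S \<le> card (arcs R `` S)" if "S \<subseteq> V" "k < card S" "card S \<le> 2 * k" for S
      by (rule big[OF that])
  qed
  then obtain W where W: "arcs R \<subseteq> W" "W \<subseteq> arcs G" "card W \<le> card (arcs R) + 3 * card V"
    and expW': "\<forall>S. S \<subseteq> V \<longrightarrow> S \<noteq> {} \<longrightarrow> card S \<le> k \<longrightarrow> 3 * card S \<le> card (W `` S)"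
    by (elim exE conjE)
  have expW: "3 * card S \<le> card (W `` S)" if "S \<subseteq> V" "S \<noteq> {}" "card S \<le> k" for S
    using expW' that by simp
  \<comment> \<open>\<open>W\<close> need not be symmetric; forgetting orientations only adds
    neighbours and does not increase the number of edges.\<close>
  define \<Gamma> where "\<Gamma> = (\<lambda>(u, v). {u, v}) ` W"
  have finW: "finite W" using W(2) finite_arcs[OF V(1) G] finite_subset by blast
  have \<Gamma>G: "\<Gamma> \<subseteq> G" using W(2) by (auto simp: \<Gamma>_def arcs_def)
  then have \<Gamma>V: "\<Gamma> \<subseteq> vpairs V" using G by blast
  have W\<Gamma>: "W \<subseteq> arcs \<Gamma>" by (force simp: \<Gamma>_def arcs_def)
  have fin\<Gamma>: "finite (arcs \<Gamma>)" by (rule finite_arcs[OF V(1) \<Gamma>V])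
  have exp\<Gamma>: "expands k V \<Gamma>"
    unfolding expands_def
  proof (intro allI impI)
    fix S assume "S \<subseteq> V" "S \<noteq> {}" "card S \<le> k"
    then have "3 * card S \<le> card (W `` S)" by (rule expW)
    also have "\<dots> \<le> card (arcs \<Gamma> `` S)" using W\<Gamma> fin\<Gamma> by (intro card_mono finite_Image) auto
    finally show "3 * card S \<le> card (arcs \<Gamma> `` S)" .
  qed
  have linked\<Gamma>: "linked V \<Gamma>"
  proof (rule expanding_linked[OF V(1) \<Gamma>V exp\<Gamma>])
    fix S assume "S \<subseteq> V" "card S = k"
    then have "n < 2 * card (arcs R `` S)" by (rule half)
    moreover have "card (arcs R `` S) \<le> card (arcs \<Gamma> `` S)"
      using W(1) W\<Gamma> fin\<Gamma> by (intro card_mono finite_Image) auto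
    ultimately show "card V < 2 * card (arcs \<Gamma> `` S)" using V(2) by linarith
  qed
  have "card \<Gamma> \<le> card W" unfolding \<Gamma>_def using finW by (rule card_image_le)
  moreover have "card (arcs R) \<le> 2 * card R" by (rule card_arcs_le[OF finR RV])
  \<comment> \<open>The relation \<open>W\<close> has at most \<open>2 * card R\<close> arcs from
    \<open>R\<close> and \<open>3 * n\<close> further ones; another \<open>n\<close> is reserved for
    the boosters.\<close>
  ultimately have "card \<Gamma> + card V \<le> 4 * (heavy_base * n) + 4 * n" using W(3) R(2) V(2) by simp
  also have "\<dots> \<le> J" using J by (simp add: algebra_simps)
  finally have "card \<Gamma> + card V \<le> J" .
  moreover have "V \<noteq> {}" using V(2) k by auto
  ultimately show ?thesis
    using hamiltonian_by_boosters[OF V(1) _ G k(1) \<Gamma>G exp\<Gamma> linked\<Gamma> _ boost] by blast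
qed

section \<open>The union bound\<close>

lemma (in logconcave_distribution) prob_missed_set:
  assumes idx: "finite K" "\<And>i. i \<in> K \<Longrightarrow> H i \<subseteq> I \<and> h \<le> real (card (H i))"
    and s: "0 < s" "\<And>e. e \<in> I \<Longrightarrow> sigma F e \<le> s" and p: "0 \<le> p"
  shows "{x \<in> space F. \<exists>i\<in>K. \<forall>e\<in>H i. p < x e} \<in> sets F"
    and "prob {x \<in> space F. \<exists>i\<in>K. \<forall>e\<in>H i. p < x e} \<le> card K * exp (- (p / (4 * s)) * h)"
proof -
  have meas: "{x \<in> space F. \<forall>e\<in>H i. p < x e} \<in> sets F" if i: "i \<in> K" for i
  proof -
    have [measurable]: "(\<lambda>x. x e) \<in> borel_measurable F" if "e \<in> H i" for e
      using that idx(2)[OF i] component_measurable by auto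
    have "finite (H i)" using idx(2)[OF i] finite_I finite_subset by blast
    then show ?thesis by measurable
  qed
  have eq: "{x \<in> space F. \<exists>i\<in>K. \<forall>e\<in>H i. p < x e} = (\<Union>i\<in>K. {x \<in> space F. \<forall>e\<in>H i. p < x e})" by auto
  show "{x \<in> space F. \<exists>i\<in>K. \<forall>e\<in>H i. p < x e} \<in> sets F"
    unfolding eq using idx(1) meas by auto
  have "prob {x \<in> space F. \<exists>i\<in>K. \<forall>e\<in>H i. p < x e} \<le> (\<Sum>i\<in>K. prob {x \<in> space F. \<forall>e\<in>H i. p < x e})"
    unfolding eq using idx(1) meas by (intro measure_UNION_le) auto
  also have "\<dots> \<le> of_nat (card K) * exp (- (p / (4 * s)) * h)"
  proof (rule sum_bounded_above)
    fix i assume i: "i \<in> K"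
    have "prob {x \<in> space F. \<forall>e\<in>H i. p < x e} \<le> exp (- (p / (4 * s)) * card (H i))"
      using idx(2)[OF i] s by (intro prob_all_components_large p) auto
    also have "\<dots> \<le> exp (- (p / (4 * s)) * h)"
      using idx(2)[OF i] s p by (auto intro!: mult_left_mono divide_right_mono)
    finally show "prob {x \<in> space F. \<forall>e\<in>H i. p < x e} \<le> exp (- (p / (4 * s)) * h)" .
  qed
  finally show "prob {x \<in> space F. \<exists>i\<in>K. \<forall>e\<in>H i. p < x e} \<le> card K * exp (- (p / (4 * s)) * h)" by simp
qed

section \<open>Counting the families of sets to be met\<close>

lemma vertex_pairs_eq: "vertex_pairs n = vpairs {1..n}"
proof -
  have "{u, v} \<in> vertex_pairs n" if "u \<in> {1..n}" "v \<in> {1..n}" "u \<noteq> v" for u v :: nat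
  proof (cases "u < v")
    case True
    then show ?thesis using that by (auto simp: vertex_pairs_def)
  next
    case False
    then have "{u, v} = {v, u}" "v < u" using that by auto
    then show ?thesis using that unfolding vertex_pairs_def by auto
  qed
  then have "vpairs {1..n} \<subseteq> vertex_pairs n" unfolding vpairs_def by auto
  moreover have "vertex_pairs n \<subseteq> vpairs {1..n}" by (auto simp: vertex_pairs_def in_vpairs_iff)
  ultimately show ?thesis by simp
qed

lemma card_vpairs: "finite V \<Longrightarrow> card (vpairs V) = card V choose 2"
proof -
  assume "finite V"
  have "vpairs V = {B. B \<subseteq> V \<and> card B = 2}" by (auto simp: vpairs_def card_2_iff)
  then show ?thesis using n_subsets[OF \<open>finite V\<close>] by simp
qed

text \<open>Padding the too small neighbourhood of \<open>S\<close> to exactly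
  \<open>3 * card S\<close> vertices turns a failure into a missed set of pairs, indexed by two
  vertex sets of prescribed sizes.\<close>

lemma expansion_failure:
  assumes V: "finite V" and G: "G \<subseteq> vpairs V" and k: "3 * k \<le> card V" and fail: "\<not> expands k V G"
  shows "\<exists>s\<in>{1..k}. \<exists>S T. S \<subseteq> V \<and> card S = s \<and> T \<subseteq> V \<and> card T = 3 * s \<and> G \<inter> cross S (V - S - T) = {}"
proof -
  obtain S where S: "S \<subseteq> V" "S \<noteq> {}" "card S \<le> k" "card (arcs G `` S) < 3 * card S"
    using fail unfolding expands_def by (auto simp: not_le)
  have finS: "finite S" using S(1) V finite_subset by blast
  have "arcs G `` S \<subseteq> V" using arcs_subset[OF G] by blast
  then obtain T where T: "arcs G `` S \<subseteq> T" "T \<subseteq> V" "card T = 3 * card S"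
    using exists_subset_between[of "arcs G `` S" "3 * card S" V] S k V by auto
  have "G \<inter> cross S (V - S - T) = {}" using T(1) by (auto simp: cross_def arcs_def)
  moreover have "card S \<in> {1..k}" using S finS by (simp add: Suc_le_eq card_gt_0_iff)
  ultimately show ?thesis using S T by blast
qed

lemma card_expansion_failures:
  assumes "finite V" "s \<ge> 1" "3 * s \<le> card V"
  shows "finite {(S, T). S \<subseteq> V \<and> card S = s \<and> T \<subseteq> V \<and> card T = 3 * s}"
    and "card {(S, T). S \<subseteq> V \<and> card S = s \<and> T \<subseteq> V \<and> card T = 3 * s} \<le> card V ^ (4 * s)"
proof -
  have eq: "{(S, T). S \<subseteq> V \<and> card S = s \<and> T \<subseteq> V \<and> card T = 3 * s}
      = {S. S \<subseteq> V \<and> card S = s} \<times> {T. T \<subseteq> V \<and> card T = 3 * s}" by auto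
  show "finite {(S, T). S \<subseteq> V \<and> card S = s \<and> T \<subseteq> V \<and> card T = 3 * s}"
    unfolding eq using assms(1) by auto
  have "card {(S, T). S \<subseteq> V \<and> card S = s \<and> T \<subseteq> V \<and> card T = 3 * s} = (card V choose s) * (card V choose (3 * s))"
    unfolding eq using assms(1) by (simp add: card_cartesian_product n_subsets)
  also have "\<dots> \<le> card V ^ s * card V ^ (3 * s)"
    using assms by (intro mult_mono binomial_le_pow) auto
  also have "\<dots> = card V ^ (4 * s)" by (simp flip: power_add)
  finally show "card {(S, T). S \<subseteq> V \<and> card S = s \<and> T \<subseteq> V \<and> card T = 3 * s} \<le> card V ^ (4 * s)" .
qed

text \<open>Lists of fixed length with a padding letter \<open>z\<close> encode all sets of at most
  \<open>J\<close> elements, so their number is bounded by a plain power.\<close>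

lemma bounded_subset_as_list:
  assumes "finite E" "E \<subseteq> P" "card E \<le> J" "z \<notin> P"
  shows "\<exists>xs. set xs \<subseteq> insert z P \<and> length xs = J \<and> set xs \<inter> P = E"
proof -
  obtain xs where xs: "set xs = E" "distinct xs" using finite_distinct_list[OF assms(1)] by blast
  then have "length xs \<le> J" using assms(3) distinct_card[of xs] by simp
  then show ?thesis using xs assms
    by (intro exI[of _ "xs @ replicate (J - length xs) z"]) (auto simp: set_replicate_conv_if)
qed

definition edge_budget :: nat where
  "edge_budget = 4 * heavy_base + 4"

text \<open>Dictated by the booster family: the factor 1000 undoes the n^2 / 1000 in the size of its
  sets, \<open>2 * edge_budget\<close> pays for the number of sparse graphs, and 3 is the surplus in
  the exponent.\<close>

definition density_const :: real where
  "density_const = 1000 * (2 * real edge_budget + 3)"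

lemma density_const_ge: "3000 \<le> density_const"
  by (simp add: density_const_def)

lemma prob_hamiltonian:
  fixes n :: nat and p s :: real
  assumes F: "logconcave_distribution F (vertex_pairs n) f" and n: "2000 \<le> n"
    and s: "0 < s" "\<And>e. e \<in> vertex_pairs n \<Longrightarrow> sigma F e \<le> s" and p: "0 \<le> p"
    and dens: "density_const * ln (real n) / real n \<le> p / (4 * s)"
  shows "1 - 3 / real n \<le> \<P>(x in F. hamiltonian {1..n} (graph_edges n p x))"
proof -
  interpret logconcave_distribution F "vertex_pairs n" f by (rule F)
  define V where "V = {1..n}"
  define q where "q = p / (4 * s)"
  \<comment> \<open>Linear in \<open>n\<close>, so that boosters are quadratically many, and small
    enough for \<open>12 * k \<le> n\<close>.\<close>
  define k where "k = n div 20"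
  \<comment> \<open>\<open>2 ^ m\<close> must exceed the number of pairs, while \<open>m\<close>
    stays O(ln n). Since \<open>ln 2\<close> is at least 2 / 3, the factor 3 gives
    \<open>2 ^ m \<ge> n ^ 2\<close>.\<close>
  define m where "m = nat \<lceil>3 * ln (real n)\<rceil>"
  define J where "J = edge_budget * n"
  have V: "finite V" "card V = n" by (auto simp: V_def)
  have IV: "vertex_pairs n = vpairs V" by (simp add: V_def vertex_pairs_eq)
  have finP: "finite (vpairs V)" by (rule finite_vpairs[OF V(1)])
  have k: "20 * k \<le> n" "n < 20 * k + 20" "100 \<le> k" using n by (auto simp: k_def)
  have kr: "5 * real n \<le> 101 * real k" "20 * real k \<le> real n" using k by linarith+
  have ln1: "1 \<le> ln (real n)"
    using exp_le n by (subst ln_ge_iff) (auto intro: order_trans[of _ 3])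
  have q: "density_const * ln (real n) \<le> q * real n" using dens n by (simp add: q_def field_simps)
  have q0: "0 \<le> q" using p s by (simp add: q_def)
  have npow: "real n ^ j = exp (real j * ln (real n))" for j
    using n by (simp add: exp_of_nat_mult)
  have small: "exp (- (c * (real n * ln (real n)))) \<le> 1 / real n" if "1 \<le> c" for c
  proof -
    have "1 * (1 * ln (real n)) \<le> c * (real n * ln (real n))" using that ln1 n by (intro mult_mono) auto
    then have "exp (- (c * (real n * ln (real n)))) \<le> exp (- ln (real n))" by simp
    also have "\<dots> = 1 / real n" using n by (simp add: exp_minus field_simps)
    finally show ?thesis .
  qed
  have m: "real m \<le> 4 * ln (real n)" "card (vpairs V) + 1 \<le> n ^ 2" "n ^ 2 \<le> 2 ^ m"
  proof -
    have m3: "3 * ln (real n) \<le> real m" "real m \<le> 3 * ln (real n) + 1" using ln1 by (auto simp: m_def)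
    then show "real m \<le> 4 * ln (real n)" using ln1 by linarith
    have "real (n ^ 2) = exp (2 * ln (real n))" using npow[of 2] by simp
    also have "\<dots> \<le> exp (real m * ln 2)"
    proof -
      have "3 * ln (real n) * (2 / 3) \<le> real m * ln 2"
        using m3 ln1 ln2_ge_two_thirds by (intro mult_mono) auto
      then show ?thesis by simp
    qed
    also have "\<dots> = real (2 ^ m)" by (simp add: exp_of_nat_mult)
    finally show "n ^ 2 \<le> 2 ^ m" by (simp only: of_nat_le_iff)
    have "2 * card (vpairs V) \<le> n * (n - 1)" by (simp add: card_vpairs[OF V(1)] V(2) choose_two)
    moreover have "n * (n - 1) + n = n ^ 2" using n by (simp add: power2_eq_square algebra_simps)
    ultimately show "card (vpairs V) + 1 \<le> n ^ 2" using n by linarith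
  qed
  have pairs_half: "2 * real (card (vpairs V)) \<le> real n * real n"
  proof -
    have "2 * card (vpairs V) \<le> n * (n - 1)" by (simp add: card_vpairs[OF V(1)] V(2) choose_two)
    also have "\<dots> \<le> n * n" by simp
    finally have "real (2 * card (vpairs V)) \<le> real (n * n)" by (simp only: of_nat_le_iff)
    then show ?thesis by simp
  qed

  \<comment> \<open>Sizes are treated separately because both sides scale with \<open>j\<close>: at
    most n^(4j) choices against sets of at least j n / 4 pairs. Each size fails with probability at
    most 1 / n^2, and there are at most \<open>n\<close> sizes.\<close>
  define K1 where "K1 j = {(S, T). S \<subseteq> V \<and> card S = j \<and> T \<subseteq> V \<and> card T = 3 * j}" for j
  define H1 where "H1 ST = (case ST of (S, T) \<Rightarrow> cross S (V - S - T))" for ST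
  define Q1 where "Q1 j = {x \<in> space F. \<exists>i\<in>K1 j. \<forall>e\<in>H1 i. p < x e}" for j
  have Q1: "Q1 j \<in> sets F \<and> prob (Q1 j) \<le> 1 / (real n)\<^sup>2" if j: "j \<in> {1..k}" for j
  proof -
    have jk: "1 \<le> j" "j \<le> k" using j by auto
    have fin: "finite (K1 j)" and card: "card (K1 j) \<le> n ^ (4 * j)"
      unfolding K1_def using card_expansion_failures[OF V(1) jk(1)] jk(2) k V(2) by auto
    have H: "H1 i \<subseteq> vertex_pairs n \<and> real j * real n / 4 \<le> real (card (H1 i))" if i: "i \<in> K1 j" for i
    proof -
      obtain S T where ST: "i = (S, T)" "S \<subseteq> V" "card S = j" "T \<subseteq> V" "card T = 3 * j"
        using i by (auto simp: K1_def)
      define B where "B = V - S - T"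
      have BV: "B \<subseteq> V" by (auto simp: B_def)
      have "card V \<le> card (B \<union> (S \<union> T))" using V(1) ST by (intro card_mono) (auto simp: B_def intro: finite_subset)
      also have "\<dots> \<le> card B + (card S + card T)" by (intro order_trans[OF card_Un_le] add_left_mono card_Un_le)
      finally have "n \<le> card B + 4 * j" using ST V(2) by simp
      \<comment> \<open>The additional 1 absorbs the degenerate pairs in
        \<open>card_cross\<close>.\<close>
      then have B: "real n / 2 + 1 \<le> card B" using jk(2) k n by linarith
      have "real (card S * card B) \<le> real (2 * card (cross S B) + card S)"
        using card_cross[OF V(1) ST(2) BV] by (simp only: of_nat_le_iff)
      then have "real j * real (card B) \<le> 2 * real (card (cross S B)) + real j" using ST(3) by simp
      moreover have "real j * (real n / 2 + 1) \<le> real j * real (card B)" using B by (intro mult_left_mono) auto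
      ultimately have "real j * real n / 4 \<le> real (card (cross S B))" by (simp add: algebra_simps)
      then show ?thesis using cross_subset[OF ST(2) BV] by (simp add: H1_def ST(1) IV B_def)
    qed
    note miss = prob_missed_set[OF fin H s p, folded q_def]
    have "prob (Q1 j) \<le> card (K1 j) * exp (- q * (real j * real n / 4))"
      unfolding Q1_def by (rule miss(2))
    also have "\<dots> \<le> real n ^ (4 * j) * exp (- q * (real j * real n / 4))"
      using card by (intro mult_right_mono) (auto simp flip: of_nat_power)
    also have "\<dots> = exp (4 * (real j * ln (real n)) - real j / 4 * (q * real n))"
      by (simp add: npow mult_exp_exp algebra_simps)
    also have "\<dots> \<le> exp (- (2 * ln (real n)))"
    proof -
      have "3000 * ln (real n) \<le> density_const * ln (real n)" using density_const_ge ln1 by (intro mult_right_mono) auto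
      then have "real j / 4 * (3000 * ln (real n)) \<le> real j / 4 * (q * real n)" using q by (intro mult_left_mono) auto
      then have "750 * (real j * ln (real n)) \<le> real j / 4 * (q * real n)" by simp
      moreover have "1 * ln (real n) \<le> real j * ln (real n)" using jk ln1 by (intro mult_right_mono) auto
      ultimately have "4 * (real j * ln (real n)) - real j / 4 * (q * real n) \<le> - (2 * ln (real n))"
        using ln1 by linarith
      then show ?thesis by simp
    qed
    also have "\<dots> = 1 / (real n)\<^sup>2" using npow[of 2] by (simp add: exp_minus inverse_eq_divide)
    finally show ?thesis using miss(1) by (simp add: Q1_def)
  qed

  define K2 where "K2 = {Zs. set Zs \<subseteq> crosses k V \<and> length Zs = m}"
  define Q2 where "Q2 = {x \<in> space F. \<exists>i\<in>K2. \<forall>e\<in>heavy V m i. p < x e}"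
  have Q2: "Q2 \<in> sets F \<and> prob Q2 \<le> 1 / real n"
  proof -
    have fin: "finite K2" unfolding K2_def by (rule finite_lists_length_eq[OF finite_crosses[OF V(1)]])
    have "card K2 = card (crosses k V) ^ m" unfolding K2_def by (rule card_lists_length_eq[OF finite_crosses[OF V(1)]])
    also have "\<dots> \<le> (4 ^ n) ^ m" using card_crosses[OF V(1), of k] V(2) by (intro power_mono) auto
    finally have "real (card K2) \<le> real ((4 ^ n) ^ m)" by (simp only: of_nat_le_iff)
    also have "\<dots> = exp (real n * real m * ln 4)"
    proof -
      have "exp (real n * real m * ln 4) = exp (real (n * m) * ln 4)" by simp
      also have "\<dots> = 4 ^ (n * m)" by (simp only: exp_of_nat_mult) simp
      finally show ?thesis by (simp add: power_mult)
    qed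
    also have "\<dots> \<le> exp (8 * (real n * ln (real n)))"
    proof -
      have "ln (4::real) = 2 * ln 2" using ln_realpow[of 2 2] by simp
      then have "ln (4::real) \<le> 2" using ln_2_less_1 by simp
      then have "real n * real m * ln 4 \<le> real n * (4 * ln (real n)) * 2" using m(1) ln1 by (intro mult_mono) auto
      then show ?thesis by (simp add: mult_ac)
    qed
    finally have card: "real (card K2) \<le> exp (8 * (real n * ln (real n)))" .
    have H: "heavy V m i \<subseteq> vertex_pairs n \<and> real n * real n / 200 \<le> real (card (heavy V m i))" if i: "i \<in> K2" for i
    proof -
      \<comment> \<open>The sets in \<open>crosses k V\<close> have at least n^2 / 90 pairs. The
        non-heavy pairs account for at most a hundredth of n^2 / 2, and 1 / 90 - 1 / 200 \<ge> 1 /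
        200.\<close>
      define c where "c = nat \<lceil>real n * real n / 90\<rceil>"
      have Z: "Z \<subseteq> vpairs V \<and> c \<le> card Z" if "Z \<in> set i" for Z
      proof -
        have "Z \<in> crosses k V" using that i by (auto simp: K2_def)
        then obtain A B where AB: "Z = cross A B" "A \<subseteq> V" "B \<subseteq> V" "card A = k" "card B = n div 2"
          unfolding crosses_def V(2) by blast
        have "real (k * (n div 2)) \<le> real (2 * card Z + k)"
          using card_cross[OF V(1) AB(2,3)] AB by (simp only: of_nat_le_iff)
        then have "real k * (real (n div 2) - 1) \<le> 2 * real (card Z)" by (simp add: algebra_simps)
        moreover have "(5 * real n / 101) * (real n * 499 / 1000) \<le> real k * (real (n div 2) - 1)"
          using kr n by (intro mult_mono) auto
        ultimately have "real n * real n / 90 \<le> real (card Z)"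
          using mult_nonneg_nonneg[of "real n" "real n"] by (simp add: field_simps)
        then have "c \<le> card Z" unfolding c_def by linarith
        then show ?thesis using cross_subset[OF AB(2,3)] AB(1) by simp
      qed
      have "0 < m" using ln1 by (simp add: m_def)
      then have "100 * c \<le> 100 * card (heavy V m i) + card (vpairs V)"
        using i Z by (intro card_heavy[OF V(1)]) (auto simp: K2_def)
      then have "100 * real c \<le> 100 * real (card (heavy V m i)) + real (card (vpairs V))" by linarith
      moreover have "real n * real n / 90 \<le> real c" by (simp add: c_def real_nat_ceiling_ge)
      ultimately have "real n * real n / 200 \<le> real (card (heavy V m i))" using pairs_half by linarith
      then show ?thesis by (auto simp: heavy_def IV)
    qed
    note miss = prob_missed_set[OF fin H s p, folded q_def]
    have "prob Q2 \<le> card K2 * exp (- q * (real n * real n / 200))" unfolding Q2_def by (rule miss(2))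
    also have "\<dots> \<le> exp (8 * (real n * ln (real n))) * exp (- q * (real n * real n / 200))"
      using card by (intro mult_right_mono) auto
    also have "\<dots> = exp (8 * (real n * ln (real n)) - real n / 200 * (q * real n))"
      by (simp add: mult_exp_exp algebra_simps)
    also have "\<dots> \<le> exp (- (7 * (real n * ln (real n))))"
    proof -
      have "3000 * ln (real n) \<le> density_const * ln (real n)" using density_const_ge ln1 by (intro mult_right_mono) auto
      then have "real n / 200 * (3000 * ln (real n)) \<le> real n / 200 * (q * real n)" using q by (intro mult_left_mono) auto
      then show ?thesis by (simp add: algebra_simps)
    qed
    also have "\<dots> \<le> 1 / real n" by (rule small) simp
    finally show ?thesis using miss(1) by (simp add: Q2_def)
  qed

  \<comment> \<open>The list \<open>xs\<close> encodes the graph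
    \<open>set xs \<inter> vpairs V\<close>, the padding letter \<open>{}\<close> being no pair.
    Lists whose graph has few boosters are left out of \<open>K3\<close>, so every set in the family
    has at least n^2 / 1000 pairs.\<close>
  define H3 where "H3 xs = boosters V (set xs \<inter> vpairs V)" for xs
  define K3 where "K3 = {xs. set xs \<subseteq> insert {} (vpairs V) \<and> length xs = J \<and> k * k \<le> 2 * card (H3 xs)}"
  define Q3 where "Q3 = {x \<in> space F. \<exists>i\<in>K3. \<forall>e\<in>H3 i. p < x e}"
  have Q3: "Q3 \<in> sets F \<and> prob Q3 \<le> 1 / real n"
  proof -
    have sub: "K3 \<subseteq> {xs. set xs \<subseteq> insert {} (vpairs V) \<and> length xs = J}" by (auto simp: K3_def)
    have finL: "finite {xs. set xs \<subseteq> insert {} (vpairs V) \<and> length xs = J}"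
      using finP by (intro finite_lists_length_eq) auto
    then have fin: "finite K3" using sub finite_subset by blast
    have "card K3 \<le> card {xs. set xs \<subseteq> insert {} (vpairs V) \<and> length xs = J}" by (rule card_mono[OF finL sub])
    also have "\<dots> = card (insert {} (vpairs V)) ^ J" using finP by (intro card_lists_length_eq) auto
    also have "\<dots> \<le> (n ^ 2) ^ J"
      using m(2) finP by (intro power_mono) (auto simp: card_insert_if)
    also have "\<dots> = n ^ (2 * J)" by (simp add: power_mult)
    finally have "real (card K3) \<le> real (n ^ (2 * J))" by (simp only: of_nat_le_iff)
    also have "\<dots> = exp (2 * real edge_budget * (real n * ln (real n)))"
      unfolding of_nat_power npow by (simp add: J_def mult_ac)
    finally have card: "real (card K3) \<le> exp (2 * real edge_budget * (real n * ln (real n)))" .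
    have H: "H3 i \<subseteq> vertex_pairs n \<and> real n * real n / 1000 \<le> real (card (H3 i))" if i: "i \<in> K3" for i
    proof -
      have "real (k * k) \<le> real (2 * card (H3 i))" using i by (simp only: K3_def mem_Collect_eq of_nat_le_iff)
      moreover have "(5 * real n / 101) * (5 * real n / 101) \<le> real k * real k" using kr by (intro mult_mono) auto
      ultimately have "real n * real n / 1000 \<le> real (card (H3 i))"
        using mult_nonneg_nonneg[of "real n" "real n"] by (simp add: field_simps)
      then show ?thesis using boosters_subset by (auto simp: H3_def IV)
    qed
    note miss = prob_missed_set[OF fin H s p, folded q_def]
    have "prob Q3 \<le> card K3 * exp (- q * (real n * real n / 1000))" unfolding Q3_def by (rule miss(2))
    also have "\<dots> \<le> exp (2 * real edge_budget * (real n * ln (real n))) * exp (- q * (real n * real n / 1000))"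
      using card by (intro mult_right_mono) auto
    also have "\<dots> = exp (2 * real edge_budget * (real n * ln (real n)) - real n / 1000 * (q * real n))"
      by (simp add: mult_exp_exp algebra_simps)
    also have "\<dots> \<le> exp (- (3 * (real n * ln (real n))))"
    proof -
      have "real n / 1000 * (density_const * ln (real n)) \<le> real n / 1000 * (q * real n)" using q by (intro mult_left_mono) auto
      then show ?thesis by (simp add: density_const_def algebra_simps)
    qed
    also have "\<dots> \<le> 1 / real n" by (rule small) simp
    finally show ?thesis using miss(1) by (simp add: Q3_def)
  qed

  define Q where "Q = (\<Union>j\<in>{1..k}. Q1 j) \<union> Q2 \<union> Q3"
  have U_sets: "(\<Union>j\<in>{1..k}. Q1 j) \<in> sets F" using Q1 by (intro sets.finite_UN) auto
  then have Q_sets: "Q \<in> sets F" unfolding Q_def using Q2 Q3 by (intro sets.Un) auto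
  have "prob Q \<le> prob ((\<Union>j\<in>{1..k}. Q1 j) \<union> Q2) + prob Q3"
    unfolding Q_def using U_sets Q2 Q3 by (intro measure_Un_le sets.Un) auto
  also have "prob ((\<Union>j\<in>{1..k}. Q1 j) \<union> Q2) \<le> prob (\<Union>j\<in>{1..k}. Q1 j) + prob Q2"
    using U_sets Q2 by (intro measure_Un_le) auto
  also have "prob (\<Union>j\<in>{1..k}. Q1 j) \<le> (\<Sum>j\<in>{1..k}. prob (Q1 j))"
    using Q1 by (intro measure_UNION_le) auto
  also have "\<dots> \<le> of_nat (card {1..k}) * (1 / (real n)\<^sup>2)" using Q1 by (intro sum_bounded_above) auto
  also have "\<dots> \<le> 1 / real n" using kr n by (simp add: power2_eq_square field_simps)
  finally have Q_small: "prob Q \<le> 3 / real n" using Q2 Q3 by simp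

  have ham: "hamiltonian V (graph_edges n p x)" if x: "x \<in> space F - Q" for x
  proof (rule hamiltonian_criterion[OF V, where k=k and m=m and J=J])
    have G: "graph_edges n p x = {e \<in> vpairs V. x e \<le> p}" by (simp add: graph_edges_def vertex_pairs_eq V_def)
    then show GV: "graph_edges n p x \<subseteq> vpairs V" by auto
    have miss: "\<forall>e\<in>H. p < x e" if "graph_edges n p x \<inter> H = {}" "H \<subseteq> vpairs V" for H
      using that unfolding G by (auto simp: not_le[symmetric])
    show "expands k V (graph_edges n p x)"
    proof (rule ccontr)
      assume "\<not> ?thesis"
      moreover have "3 * k \<le> card V" using k V(2) by simp
      ultimately obtain j S T where j: "j \<in> {1..k}" and ST: "S \<subseteq> V" "card S = j" "T \<subseteq> V" "card T = 3 * j"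
        "graph_edges n p x \<inter> cross S (V - S - T) = {}"
        using expansion_failure[OF V(1) GV] by blast
      have "(S, T) \<in> K1 j" "\<forall>e\<in>H1 (S, T). p < x e"
        using ST miss[OF ST(5)] cross_subset[OF ST(1), of "V - S - T"] by (auto simp: K1_def H1_def)
      then have "x \<in> Q1 j" using x unfolding Q1_def by blast
      then show False using x j by (auto simp: Q_def)
    qed
    show "graph_edges n p x \<inter> heavy V m Zs \<noteq> {}" if "length Zs = m" "set Zs \<subseteq> crosses k V" for Zs
    proof
      assume "graph_edges n p x \<inter> heavy V m Zs = {}"
      then have "\<forall>e\<in>heavy V m Zs. p < x e" by (rule miss) (auto simp: heavy_def)
      then have "x \<in> Q2" using x that unfolding Q2_def K2_def by blast
      then show False using x by (auto simp: Q_def)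
    qed
    show "graph_edges n p x \<inter> boosters V E \<noteq> {}"
      if E: "E \<subseteq> vpairs V" "card E \<le> J" "k * k \<le> 2 * card (boosters V E)" for E
    proof
      assume "graph_edges n p x \<inter> boosters V E = {}"
      then have "\<forall>e\<in>boosters V E. p < x e" by (rule miss) (rule boosters_subset)
      moreover have "{} \<notin> vpairs V" by (auto simp: vpairs_def)
      then obtain xs where "set xs \<subseteq> insert {} (vpairs V)" "length xs = J" "set xs \<inter> vpairs V = E"
        using bounded_subset_as_list[OF finite_subset[OF E(1) finP] E(1,2)] by blast
      ultimately have "x \<in> Q3" using x E(3) unfolding Q3_def K3_def H3_def by blast
      then show False using x by (auto simp: Q_def)
    qed
    show "card (vpairs V) < 2 ^ m" using m(2,3) by linarith
    show "(4 * heavy_base + 4) * n \<le> J" by (simp add: J_def edge_budget_def)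
  qed (use k in auto)

  \<comment> \<open>The random graph takes finitely many values, each on a set cut out by finitely
    many coordinate inequalities.\<close>
  have ham_sets: "{x \<in> space F. hamiltonian V (graph_edges n p x)} \<in> sets F"
  proof -
    have [measurable]: "(\<lambda>x. x e) \<in> borel_measurable F" if "e \<in> vpairs V" for e
      using that component_measurable IV by auto
    have "{x \<in> space F. graph_edges n p x = E} \<in> sets F" if "E \<subseteq> vpairs V" for E
    proof -
      have "{x \<in> space F. graph_edges n p x = E} = {x \<in> space F. \<forall>e\<in>vpairs V. x e \<le> p \<longleftrightarrow> e \<in> E}"
        using that by (auto simp: graph_edges_def vertex_pairs_eq V_def)
      also have "\<dots> \<in> sets F" using finP by measurable
      finally show ?thesis .
    qed
    moreover have "{x \<in> space F. hamiltonian V (graph_edges n p x)}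
      = (\<Union>E\<in>{E \<in> Pow (vpairs V). hamiltonian V E}. {x \<in> space F. graph_edges n p x = E})"
      by (auto simp: graph_edges_def vertex_pairs_eq V_def)
    ultimately show ?thesis using finP by auto
  qed
  have "1 - 3 / real n \<le> 1 - prob Q" using Q_small by simp
  also have "\<dots> = prob (space F - Q)" using Q_sets by (rule prob_compl[symmetric])
  also have "\<dots> \<le> prob {x \<in> space F. hamiltonian V (graph_edges n p x)}"
    by (intro finite_measure_mono ham_sets) (use ham in auto)
  finally show ?thesis by (simp add: V_def)
qed

theorem theorem2p4:
  "\<exists>c\<^sub>6 > (0::real). \<forall>(F :: nat \<Rightarrow> (nat set \<Rightarrow> real) measure) (p :: nat \<Rightarrow> real).
     (\<forall>n. prob_space (F n) \<and>
          (\<exists>f. has_density (vertex_pairs n) (F n) f \<and>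
               logconcave (vertex_pairs n) f \<and> down_monotone (vertex_pairs n) f)) \<longrightarrow>
     (\<forall>\<^sub>F n in sequentially.
        p n \<ge> c\<^sub>6 * sigma_max (vertex_pairs n) (F n) * (ln (real n) / real n)
               * (ln (ln (ln (real n))) / ln (ln (ln (ln (real n)))))) \<longrightarrow>
     (\<lambda>n. \<P>(x in F n. hamiltonian {1..n} (graph_edges n (p n) x))) \<longlonglongrightarrow> 1"
proof (rule exI[of _ "4 * density_const"], intro conjI allI impI)
  show "0 < 4 * density_const" using density_const_ge by simp
next
  fix F :: "nat \<Rightarrow> (nat set \<Rightarrow> real) measure" and p :: "nat \<Rightarrow> real"
  assume F: "\<forall>n. prob_space (F n) \<and>
          (\<exists>f. has_density (vertex_pairs n) (F n) f \<and>
               logconcave (vertex_pairs n) f \<and> down_monotone (vertex_pairs n) f)"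
    and p: "\<forall>\<^sub>F n in sequentially.
        p n \<ge> 4 * density_const * sigma_max (vertex_pairs n) (F n) * (ln (real n) / real n)
               * (ln (ln (ln (real n))) / ln (ln (ln (ln (real n)))))"
  \<comment> \<open>The quotient of iterated logarithms tends to infinity; once it is at least 1,
    the assumption on \<open>p n\<close> yields the bound of order
    \<open>s * ln n / n\<close>.\<close>
  have ratio: "\<forall>\<^sub>F n in sequentially. 1 \<le> ln (ln (ln (real n))) / ln (ln (ln (ln (real n))))"
    by real_asymp
  have "\<forall>\<^sub>F n in sequentially. 1 - 3 / real n \<le> \<P>(x in F n. hamiltonian {1..n} (graph_edges n (p n) x))"
    using p ratio eventually_ge_at_top[of 2000]
  proof eventually_elim
    case (elim n)
    obtain f where "has_density (vertex_pairs n) (F n) f" "logconcave (vertex_pairs n) f" "down_monotone (vertex_pairs n) f"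
      using F by blast
    then have dist: "logconcave_distribution (F n) (vertex_pairs n) f"
      using F by (intro logconcave_distribution.intro logconcave_distribution_axioms.intro)
        (auto simp: vertex_pairs_eq finite_vpairs)
    interpret logconcave_distribution "F n" "vertex_pairs n" f by (rule dist)
    define s where "s = sigma_max (vertex_pairs n) (F n)"
    have le: "sigma (F n) e \<le> s" if "e \<in> vertex_pairs n" for e
      unfolding s_def sigma_max_def using that finite_I by (intro Max_ge) auto
    \<comment> \<open>A pair exists, so the maximum is taken over a nonempty set of positive numbers
      and division by \<open>s\<close> is legitimate.\<close>
    have "{1, 2} \<in> vertex_pairs n" using elim(3) by (simp add: vertex_pairs_eq in_vpairs_iff)
    then have s: "0 < s" using sigma_pos le by (meson less_le_trans)
    have ln0: "0 \<le> ln (real n) / real n" using elim(3) by simp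
    have "4 * density_const * s * (ln (real n) / real n) * 1
      \<le> 4 * density_const * s * (ln (real n) / real n) * (ln (ln (ln (real n))) / ln (ln (ln (ln (real n)))))"
      using elim(2) s ln0 density_const_ge by (intro mult_left_mono mult_nonneg_nonneg) auto
    then have pn: "4 * density_const * s * (ln (real n) / real n) \<le> p n" using elim(1) by (simp add: s_def)
    moreover have "0 \<le> 4 * density_const * s * (ln (real n) / real n)"
      using s ln0 density_const_ge by (intro mult_nonneg_nonneg) auto
    ultimately have p0: "0 \<le> p n" by linarith
    \<comment> \<open>The 4 in the chosen constant cancels the 4 in the exponent
      \<open>p / (4 * s)\<close> of the tail bound.\<close>
    have "density_const * ln (real n) / real n \<le> p n / (4 * s)" using pn s by (simp add: field_simps)
    with le show ?case by (intro prob_hamiltonian[OF dist elim(3) s _ p0])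
  qed
  moreover have "\<forall>\<^sub>F n in sequentially. \<P>(x in F n. hamiltonian {1..n} (graph_edges n (p n) x)) \<le> 1"
    using F by (simp add: prob_space.prob_le_1)
  moreover have "(\<lambda>n. 1 - 3 / real n) \<longlonglongrightarrow> 1" by real_asymp
  ultimately show "(\<lambda>n. \<P>(x in F n. hamiltonian {1..n} (graph_edges n (p n) x))) \<longlonglongrightarrow> 1"
    by (rule tendsto_sandwich[OF _ _ _ tendsto_const])
qed

end
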